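(* Let $(\Omega_{\bullet,\bullet},d^H,d^V)$ be the aromatic bicomplex and $(\tilde\Omega_{\bullet,\bullet},d^H,d^V)$ the divergence-free aromatic bicomplex. (1) The homology of the differential $d^H$ of the aromatic bicomplex is concentrated in bi-degrees $(0,\bullet)$. (2) The homology of the differential $d^H$ of the divergence-free aromatic bicomplex is concentrated in bi-degrees $(0,\bullet)$ and $(1,\bullet)$; in the latter degrees, the homology is spanned by the one-vertex trees (with either black or white vertex). (3) The homology of the differential $d^V$ of both the aromatic bicomplex and the divergence-free aromatic bicomplex is zero.
   Context: All vector spaces are over a field $\Bbbk$ of characteristic zero. An aromatic forest is a non-empty finite directed graph each of whose connected components is either a rooted tree (all edges directed towards the root) or a directed cycle of rooted trees (a connected directed graph in which every vertex has exactly one outgoing edge; loops allowed). A labelled ordered aromatic forest is an aromatic forest whose tree components are equipped with a linear order (the cycle components are unordered) and whose vertices are coloured black and white so that the black vertices are indistinguishable and the white vertices are distinguishable, labelled by $\{1,\dots,q\}$, where $q$ is the number of white vertices; they are considered up to isomorphism. $\Omega_{p,q}$ is the space obtained from the linear span of labelled ordered aromatic forests with $p$ tree components and $q$ white vertices by anti-symmetrizing over the permutations of the tree components and over the permutations of the labels of white vertices (the sign-isotypic part for $S_p\times S_q$); the bi-degree $(p,\bullet)$ thus refers to elements with exactly $p$ tree components. The horizontal differential $d^H\colon\Omega_{p,q}\to\Omega_{p-1,q}$ is the sum of all ways of adding an edge directed from the root of the last tree component to one of the vertices of the aromatic forest (vertices of the same tree, of other trees, and of cycle components are all allowed). The vertical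 differential $d^V$, which maps the part with $q$ white vertices to the part with $q+1$ white vertices, is the skew-symmetrization over white vertices of the sum of all ways to replace a black vertex by a new white vertex. The divergence-free aromatic bicomplex $\tilde\Omega_{\bullet,\bullet}$ is the quotient of $\Omega_{\bullet,\bullet}$ by the subcomplex spanned by aromatic forests that contain at least one component with a directed cycle of length one, with the induced differentials. *)

theory Defs
  imports
    Complex_Main
    "HOL-Library.Poly_Mapping"
    "HOL-Library.Set_Algebras"
    "HOL-Combinatorics.Permutations"
begin

section \<open>Labelled ordered aromatic forests\<close>

text \<open>
  A concrete forest has vertex set \<open>{..<nverts G}\<close>.  A tree component is
  determined by its root, so the linear order of the tree components is recorded as the list
  \<open>roots G\<close> of their roots.  The white vertex with label \<open>i\<close> (counted from 1) is
  \<open>whites G ! (i - 1)\<close>; the vertices not in \<open>whites G\<close> are black.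
\<close>

datatype cforest =
  CForest (nverts: nat) (edges: "(nat \<times> nat) set") (roots: "nat list") (whites: "nat list")

definition components :: "nat set \<Rightarrow> (nat \<times> nat) set \<Rightarrow> nat set set" where
  "components V E = (\<lambda>v. (E \<union> E\<inverse>)\<^sup>* `` {v}) ` V"

definition rooted_tree :: "(nat \<times> nat) set \<Rightarrow> nat set \<Rightarrow> bool" where
  "rooted_tree E C \<longleftrightarrow>
     (\<exists>r\<in>C. (\<forall>w. (r, w) \<notin> E) \<and> (\<forall>v\<in>C. v \<noteq> r \<longrightarrow> (\<exists>!w. (v, w) \<in> E)) \<and> (\<forall>v\<in>C. (v, r) \<in> E\<^sup>*))"

definition cycle_of_trees :: "(nat \<times> nat) set \<Rightarrow> nat set \<Rightarrow> bool" where
  "cycle_of_trees E C \<longleftrightarrow> (\<forall>v\<in>C. \<exists>!w. (v, w) \<in> E)"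

definition is_forest :: "cforest \<Rightarrow> bool" where
  "is_forest G \<longleftrightarrow>
     nverts G > 0 \<and>
     edges G \<subseteq> {..<nverts G} \<times> {..<nverts G} \<and>
     (\<forall>C\<in>components {..<nverts G} (edges G). rooted_tree (edges G) C \<or> cycle_of_trees (edges G) C) \<and>
     distinct (roots G) \<and> set (roots G) = {v. v < nverts G \<and> (\<forall>w. (v, w) \<notin> edges G)} \<and>
     distinct (whites G) \<and> set (whites G) \<subseteq> {..<nverts G}"

definition forest_iso :: "cforest \<Rightarrow> cforest \<Rightarrow> bool" where
  "forest_iso G H \<longleftrightarrow>
     (\<exists>f. bij_betw f {..<nverts G} {..<nverts H} \<and>
          edges H = map_prod f f ` edges G \<and>
          roots H = map f (roots G) \<and> whites H = map f (whites G))"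

lemma components_iff_single_valued:
  assumes "E \<subseteq> V \<times> V"
  shows "(\<forall>C\<in>components V E. rooted_tree E C \<or> cycle_of_trees E C) \<longleftrightarrow> single_valued E"
proof
  assume L: "\<forall>C\<in>components V E. rooted_tree E C \<or> cycle_of_trees E C"
  show "single_valued E"
  proof (rule single_valuedI)
    fix x y z assume xy: "(x, y) \<in> E" and xz: "(x, z) \<in> E"
    let ?C = "(E \<union> E\<inverse>)\<^sup>* `` {x}"
    have "?C \<in> components V E" using xy assms by (auto simp: components_def)
    with L have "rooted_tree E ?C \<or> cycle_of_trees E ?C" by blast
    moreover have "x \<in> ?C" by auto
    ultimately have "\<exists>!w. (x, w) \<in> E"
      using xy unfolding rooted_tree_def cycle_of_trees_def by metis
    with xy xz show "y = z" by blast
  qed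
next
  assume sv: "single_valued E"
  show "\<forall>C\<in>components V E. rooted_tree E C \<or> cycle_of_trees E C"
  proof
    fix C assume "C \<in> components V E"
    then obtain v where v: "v \<in> V" "C = (E \<union> E\<inverse>)\<^sup>* `` {v}" by (auto simp: components_def)
    show "rooted_tree E C \<or> cycle_of_trees E C"
    proof (cases "\<exists>r\<in>C. \<forall>w. (r, w) \<notin> E")
      case True
      then obtain r where r: "r \<in> C" "\<And>w. (r, w) \<notin> E" by blast
      have sym: "sym ((E \<union> E\<inverse>)\<^sup>*)" by (intro sym_rtrancl) (auto simp: sym_def)
      have reach: "(u, r) \<in> E\<^sup>*" if "u \<in> C" for u
      proof -
        have "(r, v) \<in> (E \<union> E\<inverse>)\<^sup>*" using r v sym by (auto dest: symD)
        moreover have "(v, u) \<in> (E \<union> E\<inverse>)\<^sup>*" using that v by auto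
        ultimately have "(r, u) \<in> (E \<union> E\<inverse>)\<^sup>*" by (rule rtrancl_trans)
        then show ?thesis
        proof (induction rule: rtrancl_induct)
          case base then show ?case by simp
        next
          case (step y z)
          show ?case
          proof (cases "(z, y) \<in> E")
            case True then show ?thesis using step.IH by (rule converse_rtrancl_into_rtrancl)
          next
            case False
            with step.hyps have yz: "(y, z) \<in> E" by auto
            with r have "y \<noteq> r" by auto
            with step.IH obtain y' where "(y, y') \<in> E" "(y', r) \<in> E\<^sup>*"
              by (meson converse_rtranclE)
            with yz sv show ?thesis by (auto dest: single_valuedD)
          qed
        qed
      qed
      have "\<exists>!w. (u, w) \<in> E" if "u \<in> C" "u \<noteq> r" for u
        using reach[OF that(1)] that(2) sv by (meson converse_rtranclE single_valuedD)
      with r reach show ?thesis unfolding rooted_tree_def by blast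
    next
      case False
      with sv show ?thesis unfolding cycle_of_trees_def by (meson single_valuedD)
    qed
  qed
qed

lemma is_forest_iff:
  "is_forest G \<longleftrightarrow>
     nverts G > 0 \<and> edges G \<subseteq> {..<nverts G} \<times> {..<nverts G} \<and> single_valued (edges G) \<and>
     distinct (roots G) \<and> set (roots G) = {v. v < nverts G \<and> (\<forall>w. (v, w) \<notin> edges G)} \<and>
     distinct (whites G) \<and> set (whites G) \<subseteq> {..<nverts G}"
  unfolding is_forest_def using components_iff_single_valued by blast

lemma forest_iso_refl: "forest_iso G G"
  unfolding forest_iso_def by (rule exI[of _ id]) (auto simp: map_prod.id)

lemma forest_iso_sym:
  assumes "is_forest G" "forest_iso G H" shows "forest_iso H G"
proof -
  from assms(2) obtain f where f: "bij_betw f {..<nverts G} {..<nverts H}"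
    "edges H = map_prod f f ` edges G" "roots H = map f (roots G)" "whites H = map f (whites G)"
    unfolding forest_iso_def by blast
  let ?g = "inv_into {..<nverts G} f"
  have g: "?g (f x) = x" if "x < nverts G" for x
    using f(1) that by (simp add: bij_betw_def)
  have "map_prod ?g ?g ` edges H = (\<lambda>e. e) ` edges G"
    unfolding f(2) image_image using assms(1) g
    by (intro image_cong refl) (auto simp: is_forest_iff)
  moreover have "map ?g (roots H) = roots G" "map ?g (whites H) = whites G"
    using assms(1) g unfolding f is_forest_iff by (auto intro!: map_idI)
  ultimately show ?thesis
    unfolding forest_iso_def using bij_betw_inv_into[OF f(1)] by (intro exI[of _ ?g]) auto
qed

lemma forest_iso_trans:
  assumes "forest_iso G H" "forest_iso H K" shows "forest_iso G K"
proof -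
  from assms obtain f g where
    "bij_betw f {..<nverts G} {..<nverts H}"
    "edges H = map_prod f f ` edges G" "roots H = map f (roots G)" "whites H = map f (whites G)"
    "bij_betw g {..<nverts H} {..<nverts K}"
    "edges K = map_prod g g ` edges H" "roots K = map g (roots H)" "whites K = map g (whites H)"
    unfolding forest_iso_def by blast
  then show ?thesis unfolding forest_iso_def
    by (intro exI[of _ "g \<circ> f"]) (auto simp: image_image map_prod_def case_prod_unfold intro: bij_betw_trans)
qed

text \<open>Isomorphism classes of labelled ordered aromatic forests.\<close>

quotient_type forest = cforest / partial: "\<lambda>G H. is_forest G \<and> is_forest H \<and> forest_iso G H"
proof (rule part_equivpI)
  show "\<exists>G. is_forest G \<and> is_forest G \<and> forest_iso G G"
    by (rule exI[of _ "CForest 1 {} [0] []"]) (auto simp: is_forest_iff forest_iso_refl)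
qed (auto intro!: sympI transpI intro: forest_iso_sym forest_iso_trans)

lemma forest_iso_nverts: "forest_iso G H \<Longrightarrow> nverts G = nverts H"
  by (auto simp: forest_iso_def dest: bij_betw_same_card)

lift_definition num_verts :: "forest \<Rightarrow> nat" is nverts
  by (simp add: forest_iso_nverts)

lift_definition num_trees :: "forest \<Rightarrow> nat" is "\<lambda>G. length (roots G)"
  by (auto simp: forest_iso_def)

lift_definition num_whites :: "forest \<Rightarrow> nat" is "\<lambda>G. length (whites G)"
  by (auto simp: forest_iso_def)

lift_definition has_loop :: "forest \<Rightarrow> bool" is "\<lambda>G. \<exists>v. (v, v) \<in> edges G"
proof -
  have *: "\<exists>v. (v, v) \<in> edges G" if "is_forest G" "forest_iso G H" "\<exists>v. (v, v) \<in> edges H" for G H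
  proof -
    from that(2,3) obtain f v where f: "bij_betw f {..<nverts G} {..<nverts H}"
      "(v, v) \<in> map_prod f f ` edges G"
      unfolding forest_iso_def by auto
    then obtain x y where xy: "(x, y) \<in> edges G" "f x = f y" by auto
    with that(1) have "x < nverts G" "y < nverts G" by (auto simp: is_forest_iff)
    with f(1) xy(2) have "x = y" by (auto simp: bij_betw_def inj_on_def)
    with xy(1) show ?thesis by blast
  qed
  show "\<And>G H. is_forest G \<and> is_forest H \<and> forest_iso G H \<Longrightarrow>
    (\<exists>v. (v, v) \<in> edges G) = (\<exists>v. (v, v) \<in> edges H)"
    using * forest_iso_sym by blast
qed

text \<open>
  Permuting the order of the trees by \<open>s\<close> and the labels of the white vertices by \<open>t\<close>.
  The action is only meant for permutations \<open>s\<close> of \<open>{..<p}\<close> and \<open>t\<close> of \<open>{..<q}\<close> where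
  \<open>p\<close>, \<open>q\<close> are the numbers of trees and of white vertices; the guard makes it total.
\<close>

lift_definition permute_forest :: "(nat \<Rightarrow> nat) \<Rightarrow> (nat \<Rightarrow> nat) \<Rightarrow> forest \<Rightarrow> forest" is
  "\<lambda>s t G. if s permutes {..<length (roots G)} \<and> t permutes {..<length (whites G)}
           then CForest (nverts G) (edges G) (permute_list s (roots G)) (permute_list t (whites G))
           else G"
proof -
  fix s t G H assume "is_forest G \<and> is_forest H \<and> forest_iso G H"
  then obtain f where *: "is_forest G" "is_forest H" "bij_betw f {..<nverts G} {..<nverts H}"
    "edges H = map_prod f f ` edges G" "roots H = map f (roots G)" "whites H = map f (whites G)"
    unfolding forest_iso_def by blast
  let ?P = "\<lambda>G. if s permutes {..<length (roots G)} \<and> t permutes {..<length (whites G)}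
     then CForest (nverts G) (edges G) (permute_list s (roots G)) (permute_list t (whites G)) else G"
  have "is_forest (?P K)" if "is_forest K" for K
    using that by (auto simp: is_forest_iff)
  moreover have "forest_iso (?P G) (?P H)"
    unfolding forest_iso_def using * by (intro exI[of _ f]) (auto simp: permute_list_map)
  ultimately show "is_forest (?P G) \<and> is_forest (?P H) \<and> forest_iso (?P G) (?P H)"
    using * by blast
qed


section \<open>The linear span of forests\<close>

type_synonym 'k fspace = "forest \<Rightarrow>\<^sub>0 'k"

definition scale :: "'k::field_char_0 \<Rightarrow> 'k fspace \<Rightarrow> 'k fspace" where
  "scale c x = Poly_Mapping.map ((*) c) x"

lemma lookup_scale: "Poly_Mapping.lookup (scale c x) F = c * Poly_Mapping.lookup x F"
  by (simp add: scale_def map.rep_eq when_def)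

global_interpretation fs: vector_space scale
  by standard (simp_all add: poly_mapping_eq_iff fun_eq_iff lookup_scale lookup_add algebra_simps)

definition basis :: "forest \<Rightarrow> 'k::field_char_0 fspace" where
  "basis F = Poly_Mapping.single F 1"

definition linear_ext :: "(forest \<Rightarrow> 'k::field_char_0 fspace) \<Rightarrow> 'k fspace \<Rightarrow> 'k fspace" where
  "linear_ext \<phi> x = (\<Sum>F\<in>Poly_Mapping.keys x. scale (Poly_Mapping.lookup x F) (\<phi> F))"


section \<open>The aromatic bicomplex\<close>

text \<open>
  The differentials are defined on all of the span and used on \<open>Omega\<close> only.  The horizontal
  one needs no antisymmetrization: joining the last tree to the rest commutes with permuting
  the other trees.
\<close>

text \<open>The sign-isotypic part for the product of the two symmetric groups.\<close>

definition Omega :: "nat \<Rightarrow> nat \<Rightarrow> 'k::field_char_0 fspace set" where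
  "Omega p q =
     {x \<in> fs.span (basis ` {F. num_trees F = p \<and> num_whites F = q}).
        \<forall>s t. s permutes {..<p} \<longrightarrow> t permutes {..<q} \<longrightarrow>
          linear_ext (\<lambda>F. basis (permute_forest s t F)) x = scale (of_int (sign s * sign t)) x}"

definition add_edge :: "cforest \<Rightarrow> nat \<Rightarrow> cforest" where
  "add_edge G v = CForest (nverts G) (insert (last (roots G), v) (edges G)) (butlast (roots G)) (whites G)"

lemma is_forest_add_edge:
  assumes "is_forest G" "roots G \<noteq> []" "v < nverts G"
  shows "is_forest (add_edge G v)"
proof -
  obtain rs r where R: "roots G = rs @ [r]" using assms(2) by (metis rev_exhaust)
  have r: "r < nverts G" "\<And>w. (r, w) \<notin> edges G" "r \<notin> set rs" "distinct rs"
    and S: "insert r (set rs) = {v. v < nverts G \<and> (\<forall>w. (v, w) \<notin> edges G)}"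
    using assms(1) R by (auto simp: is_forest_iff)
  have "set rs = {u. u < nverts G \<and> (\<forall>w. (u, w) \<notin> insert (r, v) (edges G))}"
    using r S by (auto simp: set_eq_iff)
  with r assms R show ?thesis
    by (auto simp: is_forest_iff add_edge_def single_valued_def)
qed

lift_definition dH_forest :: "forest \<Rightarrow> 'k::field_char_0 fspace" is
  "\<lambda>G. if roots G = [] then 0 else \<Sum>v<nverts G. basis (abs_forest (add_edge G v))"
proof -
  fix G H assume "is_forest G \<and> is_forest H \<and> forest_iso G H"
  then obtain f where *: "is_forest G" "is_forest H" "bij_betw f {..<nverts G} {..<nverts H}"
    "edges H = map_prod f f ` edges G" "roots H = map f (roots G)" "whites H = map f (whites G)"
    unfolding forest_iso_def by blast
  let ?d = "\<lambda>G. if roots G = [] then 0 else \<Sum>v<nverts G. basis (abs_forest (add_edge G v)) :: 'k fspace"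
  show "?d G = ?d H"
  proof (cases "roots G = []")
    case False
    have "abs_forest (add_edge G v) = abs_forest (add_edge H (f v))" if "v < nverts G" for v
    proof -
      have "f v < nverts H" using *(3) that by (auto simp: bij_betw_def)
      moreover have "forest_iso (add_edge G v) (add_edge H (f v))"
        unfolding forest_iso_def using * False
        by (intro exI[of _ f]) (auto simp: add_edge_def last_map map_butlast)
      ultimately have "is_forest (add_edge G v) \<and> is_forest (add_edge H (f v)) \<and>
          forest_iso (add_edge G v) (add_edge H (f v))"
        using is_forest_add_edge * False that by auto
      then show ?thesis
        by (metis (mono_tags, lifting) Quotient3_rel Quotient3_forest)
    qed
    then have "(\<Sum>v<nverts G. basis (abs_forest (add_edge G v))) =
        (\<Sum>v<nverts G. basis (abs_forest (add_edge H (f v))) :: 'k fspace)"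
      by (intro sum.cong) auto
    also have "\<dots> = (\<Sum>v<nverts H. basis (abs_forest (add_edge H v)))"
      using *(3) by (rule sum.reindex_bij_betw)
    finally show ?thesis using False * by simp
  qed (use * in simp)
qed

definition dH :: "'k::field_char_0 fspace \<Rightarrow> 'k fspace" where
  "dH = linear_ext dH_forest"

definition whiten :: "cforest \<Rightarrow> nat \<Rightarrow> cforest" where
  "whiten G b = CForest (nverts G) (edges G) (roots G) (whites G @ [b])"

lift_definition whiten_forest :: "forest \<Rightarrow> 'k::field_char_0 fspace" is
  "\<lambda>G. \<Sum>b\<in>{..<nverts G} - set (whites G). basis (abs_forest (whiten G b))"
proof -
  fix G H assume "is_forest G \<and> is_forest H \<and> forest_iso G H"
  then obtain f where *: "is_forest G" "is_forest H" "bij_betw f {..<nverts G} {..<nverts H}"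
    "edges H = map_prod f f ` edges G" "roots H = map f (roots G)" "whites H = map f (whites G)"
    unfolding forest_iso_def by blast
  have sub: "set (whites G) \<subseteq> {..<nverts G}" using * by (auto simp: is_forest_iff)
  have bij: "bij_betw f ({..<nverts G} - set (whites G)) ({..<nverts H} - set (whites H))"
  proof (rule bij_betw_subset[OF *(3)])
    have "inj_on f {..<nverts G}" "f ` {..<nverts G} = {..<nverts H}"
      using *(3) by (auto simp: bij_betw_def)
    then show "f ` ({..<nverts G} - set (whites G)) = {..<nverts H} - set (whites H)"
      using inj_on_image_set_diff[of f "{..<nverts G}" "{..<nverts G}" "set (whites G)"] sub
      by (simp add: *(6) Diff_subset)
  qed blast
  have eq: "abs_forest (whiten G b) = abs_forest (whiten H (f b))"
    if "b \<in> {..<nverts G} - set (whites G)" for b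
  proof -
    have "f b \<in> {..<nverts H} - set (whites H)" using bij that by (auto simp: bij_betw_def)
    then have "is_forest (whiten G b) \<and> is_forest (whiten H (f b)) \<and>
        forest_iso (whiten G b) (whiten H (f b))"
      using that * by (auto simp: is_forest_iff whiten_def forest_iso_def intro!: exI[of _ f])
    then show ?thesis by (metis (mono_tags, lifting) Quotient3_rel Quotient3_forest)
  qed
  have "(\<Sum>b\<in>{..<nverts G} - set (whites G). basis (abs_forest (whiten G b))) =
      (\<Sum>b\<in>{..<nverts G} - set (whites G). basis (abs_forest (whiten H (f b))) :: 'k fspace)"
    by (intro sum.cong) (simp_all add: eq)
  also have "\<dots> = (\<Sum>b\<in>{..<nverts H} - set (whites H). basis (abs_forest (whiten H b)))"
    using bij by (rule sum.reindex_bij_betw)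
  finally show "(\<Sum>b\<in>{..<nverts G} - set (whites G). basis (abs_forest (whiten G b)) :: 'k fspace) =
      (\<Sum>b\<in>{..<nverts H} - set (whites H). basis (abs_forest (whiten H b)))" .
qed

definition skew_whites :: "forest \<Rightarrow> 'k::field_char_0 fspace" where
  "skew_whites F =
     scale (1 / fact (num_whites F))
       (\<Sum>t | t permutes {..<num_whites F}. scale (of_int (sign t)) (basis (permute_forest id t F)))"

definition dV :: "'k::field_char_0 fspace \<Rightarrow> 'k fspace" where
  "dV x = linear_ext skew_whites (linear_ext whiten_forest x)"


section \<open>The divergence-free aromatic bicomplex\<close>

text \<open>
  The span of the antisymmetrized forests with a directed cycle of length one.  Having such a
  cycle is invariant under the permutations, so this is the sign-isotypic part of the span.
\<close>

definition Loops :: "nat \<Rightarrow> nat \<Rightarrow> 'k::field_char_0 fspace set" where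
  "Loops p q = Omega p q \<inter> fs.span (basis ` {F. has_loop F})"

text \<open>
  The elements of the quotient are the cosets \<open>x +o Loops p q\<close>, its zero is \<open>Loops p q\<close>, and
  addition of cosets is elementwise addition of sets.  The differential induced by \<open>d\<close> sends
  a coset \<open>X\<close> to \<open>d ` X + L\<close>, where \<open>L\<close> is the subspace divided out in the target.
\<close>

definition tOmega :: "nat \<Rightarrow> nat \<Rightarrow> 'k::field_char_0 fspace set set" where
  "tOmega p q = (\<lambda>x. x +o Loops p q) ` Omega p q"

definition tdH :: "nat \<Rightarrow> nat \<Rightarrow> 'k::field_char_0 fspace set \<Rightarrow> 'k fspace set" where
  "tdH p q X = dH ` X + Loops (p - 1) q"

definition tdV :: "nat \<Rightarrow> nat \<Rightarrow> 'k::field_char_0 fspace set \<Rightarrow> 'k fspace set" where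
  "tdV p q X = dV ` X + Loops p (q + 1)"


section \<open>Homology\<close>

text \<open>
  The quotient of a space of cycles \<open>Z\<close> by a space of boundaries \<open>B\<close>, as the set of
  cosets; its zero element is \<open>B\<close>, so that it vanishes iff it equals \<open>{B}\<close>.
\<close>

definition homology :: "'a::plus set \<Rightarrow> 'a set \<Rightarrow> 'a set set" where
  "homology Z B = (\<lambda>z. z +o B) ` Z"

definition BH :: "nat \<Rightarrow> nat \<Rightarrow> 'k::field_char_0 fspace set" where
  "BH p q = dH ` Omega (p + 1) q"

definition HH :: "nat \<Rightarrow> nat \<Rightarrow> 'k::field_char_0 fspace set set" where
  "HH p q = homology {x \<in> Omega p q. dH x = 0} (BH p q)"

definition BV :: "nat \<Rightarrow> nat \<Rightarrow> 'k::field_char_0 fspace set" where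
  "BV p q = (if q = 0 then {0} else dV ` Omega p (q - 1))"

definition HV :: "nat \<Rightarrow> nat \<Rightarrow> 'k::field_char_0 fspace set set" where
  "HV p q = homology {x \<in> Omega p q. dV x = 0} (BV p q)"

definition tBH :: "nat \<Rightarrow> nat \<Rightarrow> 'k::field_char_0 fspace set set" where
  "tBH p q = tdH (p + 1) q ` tOmega (p + 1) q"

definition tHH :: "nat \<Rightarrow> nat \<Rightarrow> 'k::field_char_0 fspace set set set" where
  "tHH p q = homology {X \<in> tOmega p q. tdH p q X = Loops (p - 1) q} (tBH p q)"

definition tBV :: "nat \<Rightarrow> nat \<Rightarrow> 'k::field_char_0 fspace set set" where
  "tBV p q = (if q = 0 then {Loops p 0} else tdV p (q - 1) ` tOmega p (q - 1))"

definition tHV :: "nat \<Rightarrow> nat \<Rightarrow> 'k::field_char_0 fspace set set set" where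
  "tHV p q = homology {X \<in> tOmega p q. tdV p q X = Loops p (q + 1)} (tBV p q)"

definition one_vertex_trees :: "nat \<Rightarrow> forest set" where
  "one_vertex_trees q = {F. num_verts F = 1 \<and> num_trees F = 1 \<and> num_whites F = q}"

end

theory Submission
  imports Defs
begin

text \<open>
  Label all vertices.  A labelled forest on \<open>n\<close> vertices is a partial function on \<open>n\<close> points,
  and forests oriented by an order of the roots form the tensor product, over the vertices \<open>x\<close>, of
  the two-term complexes that send a root \<open>x\<close> to the sum of all
  edges out of \<open>x\<close>.  Each of them has an injective differential (in the divergence-free case
  because of \<open>n \<ge> 2\<close>), so the horizontal homology vanishes in positive degrees.  The
  vertical complex is a Koszul complex in the colours of the vertices and is contracted by
  any vertex.  These contractions need not be equivariant: only the boundaries that they produce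
  are symmetrized, and passing to isomorphism classes commutes with the differentials once the
  coefficients of a chain are divided by the sizes of the isomorphism classes.
\<close>

text \<open>The factor of a vertex \<open>x\<close> has the root \<open>x\<close> in degree one and
  the edges out of \<open>x\<close> in degree zero, so the total degree is the number of trees. The
  sum of the edges out of \<open>x\<close> vanishes only if no target is allowed, that is, without
  loops and for \<open>n = 1\<close>; there the factor is the field in degree one alone, which
  accounts for the one-vertex trees. As the differential of a factor is only injective, a
  contraction at one vertex handles just the forests in which this vertex is a root, and an
  induction over the vertices is needed. Whitening is an isomorphism from black to white in each
  factor, so there one contraction suffices. Classes are awkward as a basis: a forest isomorphic to
  an oddly permuted copy of itself has zero antisymmetrization. With numbered vertices nothing
  degenerates, and an antisymmetric function is an arbitrary function of the edges and the set of
  white vertices times two orientation signs. Chains are therefore treated as functions, and the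
  differentials in coefficient form, summing over the forests from which a given one arises.\<close>

lemma signed_sums_cancel:
  fixes f :: "nat \<Rightarrow> nat \<Rightarrow> 'a::field_char_0"
  assumes "finite A" "\<And>x y. x \<in> A \<Longrightarrow> y \<in> A \<Longrightarrow> x \<noteq> y \<Longrightarrow> f x y = - f y x"
  shows "(\<Sum>x\<in>A. \<Sum>y\<in>A - {x}. f x y) = 0"
proof -
  \<comment> \<open>Zeros on the diagonal turn the range into a product, so that the sums can be
    exchanged. The sum then equals its negative, hence is zero in characteristic zero.\<close>
  let ?g = "\<lambda>x y. if x = y then 0 else f x y"
  have g: "?g x y = - ?g y x" if "x \<in> A" "y \<in> A" for x y
    using assms(2)[OF that] by (cases "x = y") simp_all
  have "(\<Sum>x\<in>A. \<Sum>y\<in>A - {x}. f x y) = (\<Sum>x\<in>A. \<Sum>y\<in>A. ?g x y)" (is "?S = _")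
    using assms(1) by (intro sum.cong refl sum.mono_neutral_cong_left) auto
  also have "\<dots> = (\<Sum>y\<in>A. \<Sum>x\<in>A. ?g x y)" by (rule sum.swap)
  also have "\<dots> = (\<Sum>y\<in>A. \<Sum>x\<in>A. - ?g y x)" using g by (intro sum.cong refl) blast
  also have "\<dots> = - (\<Sum>x\<in>A. \<Sum>y\<in>A. ?g x y)" by (simp add: sum_negf)
  also have "\<dots> = - ?S" using assms(1) by (intro arg_cong[where f = uminus] sum.cong refl sum.mono_neutral_cong_right) auto
  finally show ?thesis by simp
qed

section \<open>Signs of lists\<close>

text \<open>Position \<open>i\<close> of \<open>xs\<close> holds entry \<open>s i\<close> of the
  sorted list. For a distinct list such an \<open>s\<close> exists and is unique, so the choice is
  harmless.\<close>

definition sorting_perm :: "nat list \<Rightarrow> nat \<Rightarrow> nat" where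
  "sorting_perm xs = (SOME s. s permutes {..<length xs} \<and>
     permute_list s (sorted_list_of_set (set xs)) = xs)"

definition list_sign :: "nat list \<Rightarrow> 'a::field_char_0" where
  "list_sign xs = of_int (sign (sorting_perm xs))"

lemma permutes_lessThan_permutation: "s permutes {..<n::nat} \<Longrightarrow> permutation s"
  using permutes_imp_permutation by blast

lemma sorting_perm:
  assumes "distinct xs"
  shows "sorting_perm xs permutes {..<length xs}"
    and "permute_list (sorting_perm xs) (sorted_list_of_set (set xs)) = xs"
proof -
  have "mset xs = mset (sorted_list_of_set (set xs))"
    using assms by (metis distinct_sorted_list_of_set finite_set set_eq_iff_mset_eq_distinct set_sorted_list_of_set)
  then obtain p where "p permutes {..<length (sorted_list_of_set (set xs))}"
    "permute_list p (sorted_list_of_set (set xs)) = xs" by (rule mset_eq_permutation)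
  moreover have "length (sorted_list_of_set (set xs)) = length xs"
    using assms by (simp add: distinct_card)
  ultimately have "\<exists>s. s permutes {..<length xs} \<and> permute_list s (sorted_list_of_set (set xs)) = xs"
    by auto
  from someI_ex[OF this] show "sorting_perm xs permutes {..<length xs}"
    "permute_list (sorting_perm xs) (sorted_list_of_set (set xs)) = xs"
    unfolding sorting_perm_def by auto
qed

lemma permute_list_unique:
  assumes "distinct xs" "s permutes {..<length xs}" "t permutes {..<length xs}"
    "permute_list s xs = permute_list t xs"
  shows "s = t"
proof
  fix i
  show "s i = t i"
  proof (cases "i < length xs")
    case True
    then have "xs ! s i = xs ! t i" using assms by (metis permute_list_nth)
    moreover have "s i < length xs" "t i < length xs"
      using True assms(2,3) permutes_in_image by fastforce+
    ultimately show ?thesis using assms(1) by (simp add: nth_eq_iff_index_eq)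
  next
    case False
    then show ?thesis using assms(2,3) by (simp add: permutes_def)
  qed
qed

text \<open>Both \<open>?s \<circ> t\<close> and the sorting permutation of the new list carry the
  sorted list to the new one; on a distinct list they agree, and signs are multiplicative.\<close>

lemma list_sign_permute:
  assumes "distinct xs" "t permutes {..<length xs}"
  shows "list_sign (permute_list t xs) = of_int (sign t) * (list_sign xs :: 'a::field_char_0)"
proof -
  let ?L = "sorted_list_of_set (set xs)" and ?s = "sorting_perm xs"
  let ?ys = "permute_list t xs"
  have len: "length ?L = length xs" using assms(1) by (simp add: distinct_card)
  have set: "set ?ys = set xs" and dist: "distinct ?ys" using assms by auto
  have s: "?s permutes {..<length xs}" "permute_list ?s ?L = xs" using sorting_perm[OF assms(1)] .
  have "permute_list (?s \<circ> t) ?L = ?ys"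
    using permute_list_compose[of t ?L ?s] assms(2) len s by simp
  moreover have "permute_list (sorting_perm ?ys) ?L = ?ys" using sorting_perm(2)[OF dist] set by simp
  moreover have "?s \<circ> t permutes {..<length ?L}"
    using permutes_compose[OF assms(2) s(1)] len by simp
  moreover have "sorting_perm ?ys permutes {..<length ?L}" using sorting_perm(1)[OF dist] len by simp
  ultimately have "sorting_perm ?ys = ?s \<circ> t"
    by (intro permute_list_unique[of ?L]) auto
  then show ?thesis unfolding list_sign_def
    using sign_compose[OF permutes_lessThan_permutation[OF s(1)] permutes_lessThan_permutation[OF assms(2)]]
    by simp
qed

lemma list_sign_square: "list_sign xs * list_sign xs = (1::'a::field_char_0)"
  by (simp add: list_sign_def flip: of_int_mult)

lemma list_sign_sorted: "finite A \<Longrightarrow> list_sign (sorted_list_of_set A) = (1::'a::field_char_0)"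
proof -
  assume A: "finite A"
  let ?L = "sorted_list_of_set A"
  have "sorting_perm ?L = id"
    using sorting_perm[of ?L] A by (intro permute_list_unique[of ?L]) (auto simp: permutes_id)
  then show ?thesis by (simp add: list_sign_def)
qed

text \<open>The sign of moving \<open>x\<close> from behind the sorted list of \<open>R\<close> to its sorted position.\<close>

definition eps :: "nat \<Rightarrow> nat set \<Rightarrow> 'a::field_char_0" where
  "eps x R = list_sign (sorted_list_of_set R @ [x])"

lemma permute_list_append:
  assumes "s permutes {..<length xs}"
  shows "permute_list s (xs @ ys) = permute_list s xs @ ys"
proof (rule nth_equalityI)
  fix i assume "i < length (permute_list s (xs @ ys))"
  then show "permute_list s (xs @ ys) ! i = (permute_list s xs @ ys) ! i"
    using permutes_in_image[OF assms, of i] permutes_not_in[OF assms, of i] assms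
    by (auto simp: permute_list_def nth_append map_nth simp del: map_nth)
qed simp

text \<open>The permutation that sorts \<open>xs\<close> fixes the positions of \<open>ys\<close>,
  so its sign splits off.\<close>

lemma list_sign_append:
  assumes "distinct (xs @ ys)"
  shows "list_sign (xs @ ys) =
    list_sign xs * (list_sign (sorted_list_of_set (set xs) @ ys) :: 'a::field_char_0)"
proof -
  let ?L = "sorted_list_of_set (set xs)" and ?s = "sorting_perm xs"
  have d: "distinct xs" using assms by simp
  have len: "length ?L = length xs" using d by (simp add: distinct_card)
  have s: "?s permutes {..<length xs}" "permute_list ?s ?L = xs" using sorting_perm[OF d] .
  have "permute_list ?s (?L @ ys) = xs @ ys" using permute_list_append[of ?s ?L] s len by simp
  moreover have "?s permutes {..<length (?L @ ys)}" using s(1) len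
    by (auto intro: permutes_subset)
  ultimately show ?thesis
    using list_sign_permute[of "?L @ ys" ?s] assms by (simp add: list_sign_def)
qed

lemma list_sign_snoc:
  assumes "distinct (xs @ [x])"
  shows "list_sign (xs @ [x]) = list_sign xs * (eps x (set xs) :: 'a::field_char_0)"
  unfolding eps_def using assms by (rule list_sign_append)

lemma eps_square: "eps x R * eps x R = (1::'a::field_char_0)"
  by (simp add: eps_def list_sign_square)

text \<open>Both products are signs of the sorted list of \<open>R\<close> followed by the two
  vertices, in the two possible orders; the lists differ by a transposition of the last two
  positions.\<close>

lemma eps_anticommute:
  assumes "finite R" "x \<notin> R" "y \<notin> R" "x \<noteq> y"
  shows "eps x R * eps y (insert x R) = - (eps y R * eps x (insert y R) :: 'a::field_char_0)"
proof -
  let ?L = "sorted_list_of_set R"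
  let ?t = "transpose (length ?L) (Suc (length ?L))"
  have *: "list_sign (?L @ [x, y]) = eps x R * (eps y (insert x R) :: 'a)"
    if "x \<notin> R" "y \<notin> R" "x \<noteq> y" for x y
    using that assms(1) list_sign_snoc[of "?L @ [x]" y, where ?'a = 'a] by (simp add: eps_def)
  have t: "?t permutes {..<length (?L @ [x, y])}" by (rule permutes_swap_id) auto
  have "permute_list ?t (?L @ [x, y]) = ?L @ [y, x]"
  proof (rule nth_equalityI)
    fix i assume "i < length (permute_list ?t (?L @ [x, y]))"
    then show "permute_list ?t (?L @ [x, y]) ! i = (?L @ [y, x]) ! i"
      using permute_list_nth[OF t, of i] by (auto simp: transpose_def nth_append nth_Cons')
  qed simp
  with list_sign_permute[OF _ t, where ?'a = 'a] assms
  have "list_sign (?L @ [y, x]) = - (list_sign (?L @ [x, y]) :: 'a)"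
    by (simp add: sign_swap_id)
  with *[of x y] *[of y x] assms show ?thesis by (metis minus_minus)
qed

section \<open>The Koszul complexes of labelled forests\<close>

definition del_edge :: "(nat \<times> nat) set \<Rightarrow> nat \<Rightarrow> (nat \<times> nat) set" where
  "del_edge E x = {e \<in> E. fst e \<noteq> x}"

definition root_set :: "nat \<Rightarrow> (nat \<times> nat) set \<Rightarrow> nat set" where
  "root_set n E = {..<n} - Domain E"

text \<open>The horizontal differential in coefficient form: \<open>E\<close> arises by adding an
  edge exactly from the forests \<open>del_edge E x\<close>, in which \<open>x\<close> has become a
  root, and \<open>eps\<close> moves \<open>x\<close> from the last place into the sorted order of
  the roots.\<close>

definition detach :: "nat \<Rightarrow> ((nat \<times> nat) set \<Rightarrow> 'a) \<Rightarrow> (nat \<times> nat) set \<Rightarrow> 'a::field_char_0" where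
  "detach n \<phi> E = (\<Sum>x\<in>Domain E. eps x (root_set n E) * \<phi> (del_edge E x))"

text \<open>The flag \<open>b\<close> tells whether loops are allowed: it is false in the divergence-free case.\<close>

definition valid_edges :: "bool \<Rightarrow> nat \<Rightarrow> (nat \<times> nat) set \<Rightarrow> bool" where
  "valid_edges b n E \<longleftrightarrow> E \<subseteq> {..<n} \<times> {..<n} \<and> single_valued E \<and> (b \<or> (\<forall>x. (x, x) \<notin> E))"

lemma valid_del_edge: "valid_edges b n E \<Longrightarrow> valid_edges b n (del_edge E x)"
  by (auto simp: valid_edges_def del_edge_def single_valued_def)

lemma Domain_del_edge [simp]: "Domain (del_edge E x) = Domain E - {x}"
  by (auto simp: del_edge_def)

lemma valid_Domain: "valid_edges b n E \<Longrightarrow> Domain E \<subseteq> {..<n}"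
  by (auto simp: valid_edges_def)

lemma root_set_del_edge:
  "valid_edges b n E \<Longrightarrow> x \<in> Domain E \<Longrightarrow> root_set n (del_edge E x) = insert x (root_set n E)"
  using valid_Domain by (fastforce simp: root_set_def)

lemma finite_root_set [simp]: "finite (root_set n E)"
  by (simp add: root_set_def)

lemma detach_detach:
  assumes "valid_edges b n E"
  shows "detach n (detach n \<phi>) E = (0 :: 'a::field_char_0)"
proof -
  let ?R = "root_set n E"
  have fin: "finite (Domain E)" using valid_Domain[OF assms] finite_subset by blast
  have "detach n (detach n \<phi>) E =
    (\<Sum>x\<in>Domain E. \<Sum>y\<in>Domain E - {x}.
       eps x ?R * eps y (insert x ?R) * \<phi> (del_edge (del_edge E x) y))"
    unfolding detach_def using root_set_del_edge[OF assms]
    by (intro sum.cong refl) (simp add: sum_distrib_left mult.assoc)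
  also have "\<dots> = 0"
  proof (rule signed_sums_cancel[OF fin])
    fix x y assume "x \<in> Domain E" "y \<in> Domain E" "x \<noteq> y"
    moreover from this have "x \<notin> ?R" "y \<notin> ?R" by (auto simp: root_set_def)
    moreover have "del_edge (del_edge E x) y = del_edge (del_edge E y) x" by (auto simp: del_edge_def)
    ultimately show "eps x ?R * eps y (insert x ?R) * \<phi> (del_edge (del_edge E x) y) =
      - (eps y ?R * eps x (insert y ?R) * \<phi> (del_edge (del_edge E y) x))"
      using eps_anticommute[of ?R x y, where ?'a = 'a] by simp
  qed
  finally show ?thesis .
qed

lemma detach_diff: "detach n (\<lambda>E. \<phi> E - \<psi> E) E = detach n \<phi> E - detach n \<psi> E"
  and detach_add: "detach n (\<lambda>E. \<phi> E + \<psi> E) E = detach n \<phi> E + detach n \<psi> E"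
  by (simp_all add: detach_def sum_subtractf sum.distrib algebra_simps)

text \<open>The contraction of the tensor factor of \<open>x\<close> that only retains the edge to the chosen target \<open>v\<close>.\<close>

definition attach :: "nat \<Rightarrow> nat \<Rightarrow> nat \<Rightarrow> ((nat \<times> nat) set \<Rightarrow> 'a) \<Rightarrow> (nat \<times> nat) set \<Rightarrow> 'a::field_char_0" where
  "attach n x v \<phi> E =
     (if x \<in> Domain E then 0 else eps x (root_set n E - {x}) * \<phi> (insert (x, v) E))"

text \<open>In \<open>detach n \<phi> (insert (x, v) E)\<close> the deletion of the new edge returns
  \<open>\<phi> E\<close>; every other deletion also occurs in the first summand, with the opposite
  sign. If \<open>x\<close> were not a root, the left-hand side would be \<open>\<phi>\<close> at
  \<open>E\<close> with the edge out of \<open>x\<close> redirected to \<open>v\<close>.\<close>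

lemma detach_attach:
  assumes E: "valid_edges b n E" and x: "x \<in> root_set n E"
  shows "detach n (attach n x v \<phi>) E + attach n x v (detach n \<phi>) E = (\<phi> E :: 'a::field_char_0)"
proof -
  let ?R = "root_set n E - {x}" and ?E = "insert (x, v) E"
  have xE: "x \<notin> Domain E" "x < n" and R: "root_set n E = insert x ?R" using x by (auto simp: root_set_def)
  have fin: "finite (Domain E)" using valid_Domain[OF E] finite_subset by blast
  have R': "root_set n ?E = ?R" by (auto simp: root_set_def)
  have dE: "del_edge ?E x = E" using xE by (auto simp: del_edge_def)
  have "detach n \<phi> ?E = eps x ?R * \<phi> E + (\<Sum>z\<in>Domain E. eps z ?R * \<phi> (del_edge ?E z))"
    unfolding detach_def R' using xE fin dE by (simp add: sum.insert)
  then have 1: "attach n x v (detach n \<phi>) E =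
      \<phi> E + (\<Sum>z\<in>Domain E. eps x ?R * eps z ?R * \<phi> (del_edge ?E z))"
    unfolding attach_def using xE eps_square[of x ?R, where ?'a = 'a]
    by (simp add: algebra_simps sum_distrib_left)
  have 2: "detach n (attach n x v \<phi>) E =
      (\<Sum>z\<in>Domain E. - (eps x ?R * eps z ?R * \<phi> (del_edge ?E z)))"
    unfolding detach_def
  proof (rule sum.cong[OF refl])
    fix z assume z: "z \<in> Domain E"
    then have zx: "z \<noteq> x" "z \<notin> ?R" using xE by (auto simp: root_set_def)
    have "root_set n (del_edge E z) - {x} = insert z ?R"
      using root_set_del_edge[OF E z] zx by auto
    moreover have "insert (x, v) (del_edge E z) = del_edge ?E z" using zx by (auto simp: del_edge_def)
    ultimately have a: "attach n x v \<phi> (del_edge E z) = eps x (insert z ?R) * \<phi> (del_edge ?E z)"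
      unfolding attach_def using xE by simp
    have "eps x ?R * eps z (insert x ?R) = - (eps z ?R * eps x (insert z ?R) :: 'a)"
      using zx by (intro eps_anticommute) auto
    then have "eps x ?R * (eps x ?R * eps z (insert x ?R)) * eps x (insert z ?R) =
        - (eps x ?R * (eps z ?R * (eps x (insert z ?R) * eps x (insert z ?R))) :: 'a)"
      by simp
    then have "eps z (insert x ?R) * eps x (insert z ?R) = - (eps x ?R * eps z ?R :: 'a)"
      using eps_square[of x ?R, where ?'a = 'a] eps_square[of x "insert z ?R", where ?'a = 'a]
      by (simp flip: mult.assoc)
    then show "eps z (root_set n E) * attach n x v \<phi> (del_edge E z) =
        - (eps x ?R * eps z ?R * \<phi> (del_edge ?E z))"
      unfolding a R[symmetric] by (simp flip: mult.assoc)
  qed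
  show ?thesis unfolding 1 2 by (simp add: sum_negf)
qed

text \<open>Subtracting from a cycle the boundary of its contraction at \<open>k\<close> kills its values where \<open>k\<close> is a
  root and keeps the zeros already obtained at the smaller roots; after \<open>n\<close> steps nothing is left.\<close>

lemma detach_exact:
  fixes \<phi> :: "(nat \<times> nat) set \<Rightarrow> 'a::field_char_0"
  assumes cyc: "\<And>E. valid_edges b n E \<Longrightarrow> detach n \<phi> E = 0" and n: "b \<or> n \<noteq> 1"
  shows "\<exists>\<psi>. \<forall>E. valid_edges b n E \<longrightarrow> root_set n E \<noteq> {} \<longrightarrow> detach n \<psi> E = \<phi> E"
proof -
  have "\<exists>\<psi>. \<forall>E. valid_edges b n E \<longrightarrow> (\<exists>x<k. x \<in> root_set n E) \<longrightarrow> detach n \<psi> E = \<phi> E"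
    if "k \<le> n" for k
    using that
  proof (induction k)
    case (Suc k)
    then obtain \<psi> where \<psi>: "\<And>E. valid_edges b n E \<Longrightarrow> (\<exists>x<k. x \<in> root_set n E) \<Longrightarrow> detach n \<psi> E = \<phi> E"
      by (meson Suc_leD)
    \<comment> \<open>Without loops the contraction at \<open>k\<close> needs a target other than
      \<open>k\<close>: vertex 0, or vertex 1 if \<open>k\<close> is 0. For \<open>n = 1\<close>
      only the loop is left, and then loops are allowed.\<close>
    define v where "v = (if k = 0 \<and> n \<noteq> 1 then 1 else 0::nat)"
    have v: "v < n" "b \<or> v \<noteq> k" using Suc.prems n unfolding v_def by auto
    define \<rho> where "\<rho> = (\<lambda>E. \<phi> E - detach n \<psi> E)"
    have \<rho>: "detach n \<rho> E = 0" if "valid_edges b n E" for E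
      using cyc[OF that] detach_detach[OF that, of \<psi>] unfolding \<rho>_def detach_diff by simp
    have valid_attach: "valid_edges b n (insert (k, v) E)" if "valid_edges b n E" "k \<in> root_set n E" for E
      using that v by (auto simp: valid_edges_def root_set_def single_valued_def)
    have "detach n (\<lambda>E. \<psi> E + attach n k v \<rho> E) E = \<phi> E"
      if E: "valid_edges b n E" and x: "x < Suc k" "x \<in> root_set n E" for E x
    proof (cases "k \<in> root_set n E")
      case True
      \<comment> \<open>The remainder \<open>\<rho>\<close> is again a cycle, so the homotopy
        formula at the root \<open>k\<close> returns \<open>\<rho>\<close> itself.\<close>
      have "attach n k v (detach n \<rho>) E = 0"
        unfolding attach_def using \<rho>[OF valid_attach[OF E True]] by simp
      with detach_attach[OF E True, of v \<rho>] show ?thesis unfolding detach_add \<rho>_def by simp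
    next
      case False
      then have xk: "x < k" using x less_Suc_eq by auto
      \<comment> \<open>Deleting an edge and attaching \<open>k\<close> leaves the smaller root
        \<open>x\<close> a root, and there \<open>\<rho>\<close> already vanishes; so the correction
        does not change the boundary at \<open>E\<close>.\<close>
      have "attach n k v \<rho> (del_edge E z) = 0" if z: "z \<in> Domain E" for z
      proof (cases "k \<in> Domain (del_edge E z)")
        case k: False
        then have "k \<in> root_set n (del_edge E z)" using Suc.prems by (auto simp: root_set_def)
        with E have "valid_edges b n (insert (k, v) (del_edge E z))"
          by (intro valid_attach valid_del_edge)
        moreover have "x \<in> root_set n (insert (k, v) (del_edge E z))"
          using x(2) xk by (auto simp: root_set_def)
        ultimately have "detach n \<psi> (insert (k, v) (del_edge E z)) = \<phi> (insert (k, v) (del_edge E z))"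
          using xk by (intro \<psi>) blast+
        then have "\<rho> (insert (k, v) (del_edge E z)) = 0" unfolding \<rho>_def by simp
        then show ?thesis by (simp add: attach_def)
      qed (simp add: attach_def)
      then have "detach n (attach n k v \<rho>) E = 0" by (simp add: detach_def)
      then show ?thesis unfolding detach_add using \<psi> E x(2) xk by auto
    qed
    then show ?case by blast
  qed auto
  from this[OF order_refl] obtain \<psi> where
    "\<And>E. valid_edges b n E \<Longrightarrow> (\<exists>x<n. x \<in> root_set n E) \<Longrightarrow> detach n \<psi> E = \<phi> E" by blast
  moreover have "\<exists>x<n. x \<in> root_set n E" if "root_set n E \<noteq> {}" for E
    using that unfolding root_set_def by blast
  ultimately show ?thesis by blast
qed

section \<open>The Koszul complex of the colours\<close>

definition blacken :: "(nat set \<Rightarrow> 'a) \<Rightarrow> nat set \<Rightarrow> 'a::field_char_0" where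
  "blacken \<phi> W = (\<Sum>w\<in>W. eps w (W - {w}) * \<phi> (W - {w}))"

text \<open>The contracting vertex is 0, which exists because \<open>n > 0\<close>. Whitening
  exchanges its two colours isomorphically, so a single contraction works whether or not
  \<open>W\<close> contains 0.\<close>

lemma blacken_exact:
  fixes \<phi> :: "nat set \<Rightarrow> 'a::field_char_0"
  assumes cyc: "\<And>W. W \<subseteq> {..<n} \<Longrightarrow> blacken \<phi> W = 0" and n: "n > 0"
  defines "\<psi> \<equiv> (\<lambda>W. if 0 \<in> W then 0 else eps 0 W * \<phi> (insert 0 W))"
  assumes W: "W \<subseteq> {..<n}"
  shows "blacken \<psi> W = \<phi> W"
proof -
  have fin: "finite W" using W finite_subset by blast
  show ?thesis
  proof (cases "0 \<in> W")
    case True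
    \<comment> \<open>Every term with \<open>w \<noteq> 0\<close> vanishes, since
      \<open>W - {w}\<close> still contains 0.\<close>
    have "blacken \<psi> W = eps 0 (W - {0}) * \<psi> (W - {0})"
      unfolding blacken_def using True fin by (subst sum.remove[of _ 0]) (auto simp: \<psi>_def)
    then show ?thesis unfolding \<psi>_def using True eps_square[of 0 "W - {0}", where ?'a = 'a]
      by (simp add: insert_absorb flip: mult.assoc)
  next
    case False
    \<comment> \<open>The cycle condition with one more white vertex expresses
      \<open>\<phi> W\<close> through values at sets containing 0, which are those that enter
      \<open>\<psi>\<close>.\<close>
    have "0 = blacken \<phi> (insert 0 W)" using cyc W n by auto
    also have "\<dots> = eps 0 W * \<phi> W +
        (\<Sum>w\<in>W. eps w (insert 0 (W - {w})) * \<phi> (insert 0 (W - {w})))"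
      unfolding blacken_def using False fin
      by (subst sum.insert) (auto simp: insert_Diff_if intro!: sum.cong)
    finally have "0 = eps 0 W * (eps 0 W * \<phi> W +
        (\<Sum>w\<in>W. eps w (insert 0 (W - {w})) * \<phi> (insert 0 (W - {w}))))" by simp
    also have "\<dots> = \<phi> W +
        (\<Sum>w\<in>W. eps 0 W * eps w (insert 0 (W - {w})) * \<phi> (insert 0 (W - {w})))"
      using eps_square[of 0 W, where ?'a = 'a] by (simp add: algebra_simps sum_distrib_left)
    also have "(\<Sum>w\<in>W. eps 0 W * eps w (insert 0 (W - {w})) * \<phi> (insert 0 (W - {w}))) =
        (\<Sum>w\<in>W. - (eps w (W - {w}) * \<psi> (W - {w})))"
    proof (rule sum.cong[OF refl])
      fix w assume w: "w \<in> W"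
      then have "w \<noteq> 0" using False by metis
      let ?U = "W - {w}"
      have W: "insert w ?U = W" using w by auto
      have "eps 0 ?U * eps w (insert 0 ?U) = - (eps w ?U * eps 0 (insert w ?U) :: 'a)"
        using \<open>w \<noteq> 0\<close> False fin by (intro eps_anticommute) auto
      then have "eps 0 ?U * (eps 0 ?U * eps w (insert 0 ?U)) * eps 0 W =
          - (eps 0 ?U * eps w ?U * (eps 0 W * eps 0 W) :: 'a)" unfolding W by simp
      then have "eps 0 W * eps w (insert 0 ?U) = - (eps w ?U * eps 0 ?U :: 'a)"
        using eps_square[of 0 ?U, where ?'a = 'a] eps_square[of 0 W, where ?'a = 'a]
        by (simp add: mult.commute flip: mult.assoc)
      then show "eps 0 W * eps w (insert 0 ?U) * \<phi> (insert 0 ?U) = - (eps w ?U * \<psi> ?U)"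
        unfolding \<psi>_def using False by simp
    qed
    finally show ?thesis by (simp add: blacken_def sum_negf)
  qed
qed

section \<open>Linear combinations of forests\<close>

lemma linear_ext_superset:
  assumes "finite A" "Poly_Mapping.keys x \<subseteq> A"
  shows "linear_ext \<phi> x = (\<Sum>F\<in>A. scale (Poly_Mapping.lookup x F) (\<phi> F))"
  unfolding linear_ext_def using assms
  by (intro sum.mono_neutral_left) (auto simp: in_keys_iff)

lemma linear_ext_add: "linear_ext \<phi> (x + y) = linear_ext \<phi> x + linear_ext \<phi> y"
proof -
  let ?A = "Poly_Mapping.keys x \<union> Poly_Mapping.keys y"
  have A: "finite ?A" "Poly_Mapping.keys (x + y) \<subseteq> ?A" "Poly_Mapping.keys x \<subseteq> ?A"
    "Poly_Mapping.keys y \<subseteq> ?A" using keys_add[of x y] by auto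
  show ?thesis
    unfolding linear_ext_superset[OF A(1,2)] linear_ext_superset[OF A(1,3)]
      linear_ext_superset[OF A(1,4)]
    by (simp add: lookup_add fs.scale_left_distrib sum.distrib)
qed

lemma linear_ext_scale: "linear_ext \<phi> (scale c x) = scale c (linear_ext \<phi> x)"
proof -
  have "Poly_Mapping.keys (scale c x) \<subseteq> Poly_Mapping.keys x"
    by (auto simp: in_keys_iff lookup_scale)
  then have "linear_ext \<phi> (scale c x) =
      (\<Sum>F\<in>Poly_Mapping.keys x. scale (Poly_Mapping.lookup (scale c x) F) (\<phi> F))"
    by (intro linear_ext_superset) auto
  then show ?thesis by (simp add: linear_ext_def lookup_scale fs.scale_sum_right)
qed

lemma linear_ext_0 [simp]: "linear_ext \<phi> 0 = 0"
  by (simp add: linear_ext_def)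

lemma linear_ext_basis [simp]: "linear_ext \<phi> (basis F) = \<phi> F"
  by (simp add: linear_ext_def basis_def)

lemma linear_ext_sum: "linear_ext \<phi> (\<Sum>i\<in>I. g i) = (\<Sum>i\<in>I. linear_ext \<phi> (g i))"
  by (induction I rule: infinite_finite_induct) (simp_all add: linear_ext_add)

lemma lookup_basis: "Poly_Mapping.lookup (basis F) F' = (if F = F' then 1 else 0)"
  by (simp add: basis_def lookup_single when_def)

lemma eq_sum_basis:
  "x = (\<Sum>F\<in>Poly_Mapping.keys x. scale (Poly_Mapping.lookup x F) (basis F))"
proof (rule poly_mapping_eqI)
  fix F
  have "Poly_Mapping.lookup (\<Sum>F\<in>Poly_Mapping.keys x. scale (Poly_Mapping.lookup x F) (basis F)) F =
      (\<Sum>F'\<in>Poly_Mapping.keys x. if F' = F then Poly_Mapping.lookup x F' else 0)"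
    unfolding lookup_sum by (intro sum.cong refl) (simp add: lookup_scale lookup_basis)
  then show "Poly_Mapping.lookup x F =
      Poly_Mapping.lookup (\<Sum>F\<in>Poly_Mapping.keys x. scale (Poly_Mapping.lookup x F) (basis F)) F"
    by (simp add: in_keys_iff)
qed

lemma span_basis_iff: "x \<in> fs.span (basis ` A) \<longleftrightarrow> Poly_Mapping.keys x \<subseteq> A"
proof
  assume "x \<in> fs.span (basis ` A)"
  then show "Poly_Mapping.keys x \<subseteq> A"
  proof (induction rule: fs.span_induct_alt)
    case (step c y z)
    then obtain F where F: "F \<in> A" "y = basis F" by auto
    have "Poly_Mapping.keys (scale c y) \<subseteq> A"
      using F by (auto simp: in_keys_iff lookup_scale lookup_basis split: if_splits)
    then show ?case using step.IH keys_add[of "scale c y" z] by blast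
  qed simp
next
  assume A: "Poly_Mapping.keys x \<subseteq> A"
  have "(\<Sum>F\<in>Poly_Mapping.keys x. scale (Poly_Mapping.lookup x F) (basis F)) \<in> fs.span (basis ` A)"
    using A by (intro fs.span_sum fs.span_scale fs.span_base) auto
  then show "x \<in> fs.span (basis ` A)" by (metis eq_sum_basis)
qed

lemma lookup_eq_0_if_span:
  "x \<in> fs.span (basis ` {F. P F}) \<longleftrightarrow> (\<forall>F. \<not> P F \<longrightarrow> Poly_Mapping.lookup x F = 0)"
  unfolding span_basis_iff by (auto simp: in_keys_iff)

section \<open>Representatives\<close>

lemma abs_forest_eq_iff:
  assumes "is_forest G" "is_forest H"
  shows "abs_forest G = abs_forest H \<longleftrightarrow> forest_iso G H"
  using Quotient3_rel[OF Quotient3_forest, of G H] assms forest_iso_refl by auto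

lemma forest_representative: "\<exists>G. is_forest G \<and> F = abs_forest G"
  using Quotient3_rep_reflp[OF Quotient3_forest, of F] Quotient3_abs_rep[OF Quotient3_forest, of F]
  by metis

lemma num_abs_forest [simp]:
  assumes "is_forest G"
  shows "num_verts (abs_forest G) = nverts G" "num_trees (abs_forest G) = length (roots G)"
    "num_whites (abs_forest G) = length (whites G)"
    "has_loop (abs_forest G) \<longleftrightarrow> (\<exists>v. (v, v) \<in> edges G)"
  using assms forest_iso_refl
  by (simp_all add: num_verts.abs_eq num_trees.abs_eq num_whites.abs_eq has_loop.abs_eq)

definition permute_cforest :: "(nat \<Rightarrow> nat) \<Rightarrow> (nat \<Rightarrow> nat) \<Rightarrow> cforest \<Rightarrow> cforest" where
  "permute_cforest s t G =
     CForest (nverts G) (edges G) (permute_list s (roots G)) (permute_list t (whites G))"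

lemma permute_cforest_sel [simp]:
  "nverts (permute_cforest s t G) = nverts G" "edges (permute_cforest s t G) = edges G"
  "roots (permute_cforest s t G) = permute_list s (roots G)"
  "whites (permute_cforest s t G) = permute_list t (whites G)"
  by (simp_all add: permute_cforest_def)

lemma is_forest_permute:
  assumes "is_forest G" "s permutes {..<length (roots G)}" "t permutes {..<length (whites G)}"
  shows "is_forest (permute_cforest s t G)"
  using assms by (auto simp: is_forest_iff)

lemma permute_abs_forest:
  assumes "is_forest G" "s permutes {..<length (roots G)}" "t permutes {..<length (whites G)}"
  shows "permute_forest s t (abs_forest G) = abs_forest (permute_cforest s t G)"
  using assms forest_iso_refl by (simp add: permute_forest.abs_eq permute_cforest_def)

lemma permute_cforest_inverse:
  assumes "s permutes {..<length (roots G)}" "t permutes {..<length (whites G)}"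
  shows "permute_cforest (inv s) (inv t) (permute_cforest s t G) = G"
    and "permute_cforest s t (permute_cforest (inv s) (inv t) G) = G"
proof -
  have *: "permute_list (inv f) (permute_list f xs) = xs" "permute_list f (permute_list (inv f) xs) = xs"
    if "f permutes {..<length xs}" for f and xs :: "nat list"
    using permute_list_compose[OF permutes_inv[OF that], of f] permute_list_compose[OF that, of "inv f"]
      permutes_inv_o[OF that] by simp_all
  show "permute_cforest (inv s) (inv t) (permute_cforest s t G) = G"
    "permute_cforest s t (permute_cforest (inv s) (inv t) G) = G"
    using *[OF assms(1)] *[OF assms(2)] by (simp_all add: permute_cforest_def)
qed

section \<open>Finite sets of representatives and the passage to classes\<close>

definition cforests :: "nat \<Rightarrow> nat \<Rightarrow> nat \<Rightarrow> cforest set" where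
  "cforests M p q = {G. is_forest G \<and> nverts G \<le> M \<and> length (roots G) = p \<and> length (whites G) = q}"

lemma cforestsD:
  assumes "G \<in> cforests M p q"
  shows "is_forest G" "nverts G \<le> M" "length (roots G) = p" "length (whites G) = q"
  using assms by (simp_all add: cforests_def)

lemma finite_cforests [simp]: "finite (cforests M p q)"
proof (rule finite_subset)
  let ?L = "\<lambda>k. {xs. set xs \<subseteq> {..<M} \<and> length xs = k}"
  let ?A = "{..M} \<times> Pow ({..<M} \<times> {..<M}) \<times> ?L p \<times> ?L q"
  show "cforests M p q \<subseteq> (\<lambda>(n, E, rs, ws). CForest n E rs ws) ` ?A"
  proof
    fix G assume G: "G \<in> cforests M p q"
    have "(nverts G, edges G, roots G, whites G) \<in> ?A"
      using cforestsD[OF G] unfolding is_forest_iff by fastforce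
    then show "G \<in> (\<lambda>(n, E, rs, ws). CForest n E rs ws) ` ?A"
      by (rule rev_image_eqI) simp
  qed
  show "finite ((\<lambda>(n, E, rs, ws). CForest n E rs ws) ` ?A)"
    by (intro finite_imageI finite_cartesian_product finite_lists_length_eq) auto
qed

lemma permute_cforests:
  assumes "s permutes {..<p}" "t permutes {..<q}" "G \<in> cforests M p q"
  shows "permute_cforest s t G \<in> cforests M p q"
  using assms is_forest_permute by (auto simp: cforests_def)

lemma bij_betw_permute_cforests:
  assumes s: "s permutes {..<p}" and t: "t permutes {..<q}"
  shows "bij_betw (permute_cforest s t) (cforests M p q) (cforests M p q)"
  using permute_cforests[OF s t] permute_cforests[OF permutes_inv[OF s] permutes_inv[OF t]]
  by (intro bij_betw_byWitness[of _ "permute_cforest (inv s) (inv t)"])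
    (auto simp: permute_cforest_inverse s t cforestsD)

text \<open>A class contributes once for each of its concrete representatives. The bound
  \<open>M\<close> on the vertices keeps the sum finite; the support of a single chain always fits
  below some \<open>M\<close>.\<close>

definition realize :: "nat \<Rightarrow> nat \<Rightarrow> nat \<Rightarrow> (cforest \<Rightarrow> 'k::field_char_0) \<Rightarrow> 'k fspace" where
  "realize M p q u = (\<Sum>G\<in>cforests M p q. scale (u G) (basis (abs_forest G)))"

lemma realize_cong:
  "(\<And>G. G \<in> cforests M p q \<Longrightarrow> u G = v G) \<Longrightarrow> realize M p q u = realize M p q v"
  by (simp add: realize_def)

lemma realize_scale: "realize M p q (\<lambda>G. c * u G) = scale c (realize M p q u)"
  by (simp add: realize_def fs.scale_sum_right)

lemma realize_sum: "realize M p q (\<lambda>G. \<Sum>i\<in>I. u i G) = (\<Sum>i\<in>I. realize M p q (u i))"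
  unfolding realize_def fs.scale_sum_left by (rule sum.swap)

lemma linear_ext_realize:
  "linear_ext \<phi> (realize M p q u) = (\<Sum>G\<in>cforests M p q. scale (u G) (\<phi> (abs_forest G)))"
  by (simp add: realize_def linear_ext_sum linear_ext_scale)

lemma lookup_realize:
  "Poly_Mapping.lookup (realize M p q u) F =
     (\<Sum>G | G \<in> cforests M p q \<and> abs_forest G = F. u G)"
proof -
  have "Poly_Mapping.lookup (realize M p q u) F =
      (\<Sum>G\<in>cforests M p q. if abs_forest G = F then u G else 0)"
    unfolding realize_def lookup_sum by (intro sum.cong refl) (simp add: lookup_scale lookup_basis)
  then show ?thesis by (simp add: sum.inter_filter)
qed

lemma lookup_realize_invariant:
  assumes "\<And>G. G \<in> cforests M p q \<Longrightarrow> abs_forest G = F \<Longrightarrow> u G = c"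
  shows "Poly_Mapping.lookup (realize M p q u) F =
    of_nat (card {G \<in> cforests M p q. abs_forest G = F}) * c"
  unfolding lookup_realize using assms by simp

lemma permute_realize:
  assumes s: "s permutes {..<p}" and t: "t permutes {..<q}"
  shows "linear_ext (\<lambda>F. basis (permute_forest s t F)) (realize M p q u) =
    realize M p q (\<lambda>G. u (permute_cforest (inv s) (inv t) G))"
proof -
  have "linear_ext (\<lambda>F. basis (permute_forest s t F)) (realize M p q u) =
      (\<Sum>G\<in>cforests M p q. scale (u (permute_cforest (inv s) (inv t) (permute_cforest s t G)))
        (basis (abs_forest (permute_cforest s t G))))"
    unfolding linear_ext_realize
    by (intro sum.cong refl) (simp add: permute_abs_forest permute_cforest_inverse s t cforestsD)
  also have "\<dots> = realize M p q (\<lambda>G. u (permute_cforest (inv s) (inv t) G))"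
    unfolding realize_def by (rule sum.reindex_bij_betw[OF bij_betw_permute_cforests[OF s t]])
  finally show ?thesis .
qed

section \<open>Antisymmetric functions\<close>

text \<open>The signs turn functions that ignore both orders into antisymmetric ones, and all
  antisymmetric functions arise in this way.\<close>

definition oriented :: "(nat \<Rightarrow> (nat \<times> nat) set \<Rightarrow> nat set \<Rightarrow> 'k) \<Rightarrow> cforest \<Rightarrow> 'k::field_char_0" where
  "oriented \<phi> G =
     list_sign (roots G) * list_sign (whites G) * \<phi> (nverts G) (edges G) (set (whites G))"

definition antisymmetric :: "nat \<Rightarrow> nat \<Rightarrow> (cforest \<Rightarrow> 'k::field_char_0) \<Rightarrow> bool" where
  "antisymmetric p q u \<longleftrightarrow> (\<forall>G s t. is_forest G \<longrightarrow> length (roots G) = p \<longrightarrow> length (whites G) = q \<longrightarrow>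
     s permutes {..<p} \<longrightarrow> t permutes {..<q} \<longrightarrow>
     u (permute_cforest s t G) = of_int (sign s * sign t) * u G)"

lemma antisymmetric_oriented: "antisymmetric p q (oriented \<phi>)"
  unfolding antisymmetric_def oriented_def
  by (auto simp: list_sign_permute is_forest_iff)

definition standardize :: "nat \<Rightarrow> (nat \<times> nat) set \<Rightarrow> nat set \<Rightarrow> cforest" where
  "standardize n E W = CForest n E (sorted_list_of_set (root_set n E)) (sorted_list_of_set W)"

lemma set_roots: "is_forest G \<Longrightarrow> set (roots G) = root_set (nverts G) (edges G)"
  by (auto simp: is_forest_iff root_set_def)

lemma is_forest_standardize:
  assumes "n > 0" "valid_edges b n E" "W \<subseteq> {..<n}"
  shows "is_forest (standardize n E W)"
  using assms finite_subset[OF assms(3)] unfolding is_forest_iff standardize_def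
  by (auto simp: valid_edges_def root_set_def)

lemma valid_edges_forest: "is_forest G \<Longrightarrow> b \<or> (\<forall>x. (x, x) \<notin> edges G) \<Longrightarrow> valid_edges b (nverts G) (edges G)"
  by (simp add: is_forest_iff valid_edges_def)

lemma oriented_standardize:
  "finite W \<Longrightarrow> oriented \<phi> (standardize n E W) = \<phi> n E W"
  by (simp add: oriented_def standardize_def list_sign_sorted)

text \<open>Every forest is its standard form with both lists permuted by their sorting
  permutations, and the signs of these are the list signs.\<close>

lemma antisymmetric_eq_oriented:
  assumes u: "antisymmetric p q u" and G: "is_forest G" "length (roots G) = p" "length (whites G) = q"
  shows "u G = oriented (\<lambda>n E W. u (standardize n E W)) G"
proof -
  have d: "distinct (roots G)" "distinct (whites G)" using G by (auto simp: is_forest_iff)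
  let ?s = "sorting_perm (roots G)" and ?t = "sorting_perm (whites G)"
  let ?H = "standardize (nverts G) (edges G) (set (whites G))"
  have H: "is_forest ?H"
    using G valid_edges_forest[OF G(1), of True]
    by (intro is_forest_standardize) (auto simp: is_forest_iff)
  have eq: "permute_cforest ?s ?t ?H = G"
    unfolding permute_cforest_def standardize_def
    using sorting_perm(2)[OF d(1)] sorting_perm(2)[OF d(2)] by (simp add: set_roots[OF G(1)])
  have "length (roots ?H) = p" "length (whites ?H) = q"
    using G d by (auto simp: standardize_def distinct_card simp flip: set_roots[OF G(1)])
  then have "u (permute_cforest ?s ?t ?H) = of_int (sign ?s * sign ?t) * u ?H"
    using u[unfolded antisymmetric_def, rule_format, OF H, of ?s ?t]
      sorting_perm(1)[OF d(1)] sorting_perm(1)[OF d(2)] G(2,3) by simp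
  then show ?thesis unfolding eq by (simp add: oriented_def list_sign_def)
qed

lemma realize_in_Omega:
  assumes u: "antisymmetric p q u"
  shows "realize M p q u \<in> Omega p q"
  unfolding Omega_def
proof (intro CollectI conjI allI impI)
  show "realize M p q u \<in> fs.span (basis ` {F. num_trees F = p \<and> num_whites F = q})"
    unfolding realize_def
    by (intro fs.span_sum fs.span_scale fs.span_base) (auto simp: cforestsD)
  fix s t :: "nat \<Rightarrow> nat" assume s: "s permutes {..<p}" and t: "t permutes {..<q}"
  have sgn: "sign (inv s) = sign s" "sign (inv t) = sign t"
    using s t by (auto intro!: sign_inverse permutes_lessThan_permutation)
  show "linear_ext (\<lambda>F. basis (permute_forest s t F)) (realize M p q u) =
      scale (of_int (sign s * sign t)) (realize M p q u)"
    unfolding permute_realize[OF s t] realize_scale[symmetric]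
    using u permutes_inv[OF s] permutes_inv[OF t] sgn
    by (intro realize_cong) (auto simp: antisymmetric_def cforests_def)
qed

text \<open>Dividing by the size of the isomorphism class makes \<open>realize\<close> invert \<open>density\<close>.\<close>

definition density :: "nat \<Rightarrow> 'k fspace \<Rightarrow> cforest \<Rightarrow> 'k::field_char_0" where
  "density M x G = Poly_Mapping.lookup x (abs_forest G) /
     of_nat (card {H \<in> cforests M (length (roots G)) (length (whites G)). abs_forest H = abs_forest G})"

lemma density_iso:
  assumes "is_forest G" "is_forest H" "forest_iso G H"
  shows "density M x G = density M x H"
  using abs_forest_eq_iff[OF assms(1,2)] assms(3) by (auto simp: density_def forest_iso_def)

text \<open>The density is constant on a class, so summing over the class restores the coefficient.
  A class in the support is met because \<open>M\<close> bounds its vertices, and its size is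
  invertible in characteristic zero.\<close>

lemma realize_density:
  assumes x: "x \<in> Omega p q" and M: "\<And>F. F \<in> Poly_Mapping.keys x \<Longrightarrow> num_verts F \<le> M"
  shows "realize M p q (density M x) = x"
proof (rule poly_mapping_eqI)
  fix F
  let ?C = "{G \<in> cforests M p q. abs_forest G = F}"
  have "Poly_Mapping.lookup (realize M p q (density M x)) F =
      of_nat (card ?C) * (Poly_Mapping.lookup x F / of_nat (card ?C))"
    by (rule lookup_realize_invariant) (auto simp: density_def cforestsD)
  also have "\<dots> = Poly_Mapping.lookup x F"
  proof (cases "F \<in> Poly_Mapping.keys x")
    case True
    obtain G where G: "is_forest G" "F = abs_forest G" using forest_representative by blast
    have "num_trees F = p" "num_whites F = q"
      using x True unfolding Omega_def span_basis_iff by auto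
    then have "G \<in> ?C" using G M[OF True] by (simp add: cforests_def)
    moreover have "finite ?C" by simp
    ultimately have "card ?C \<noteq> 0" by (metis card_0_eq empty_iff)
    then show ?thesis by simp
  qed (simp add: in_keys_iff)
  finally show "Poly_Mapping.lookup (realize M p q (density M x)) F = Poly_Mapping.lookup x F" .
qed

text \<open>The coefficient of the permuted forest in the permuted chain is that of the forest in
  \<open>x\<close>. The permuted chain is \<open>x\<close> up to a sign of square one, which can
  change sides.\<close>

lemma Omega_lookup_permute:
  assumes x: "x \<in> Omega p q" and s: "s permutes {..<p}" and t: "t permutes {..<q}"
    and G: "is_forest G" "length (roots G) = p" "length (whites G) = q"
  shows "Poly_Mapping.lookup x (abs_forest (permute_cforest s t G)) =
    of_int (sign s * sign t) * Poly_Mapping.lookup x (abs_forest G)"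
proof -
  let ?P = "\<lambda>F. permute_forest s t F"
  \<comment> \<open>The guard of \<open>permute_forest\<close> depends on the numbers of trees and
    white vertices, so injectivity is proved on the support of \<open>x\<close>, where these are
    \<open>p\<close> and \<open>q\<close>.\<close>
  have inj: "F = abs_forest G" if F: "F \<in> Poly_Mapping.keys x" "?P F = ?P (abs_forest G)" for F
  proof -
    obtain H where H: "is_forest H" "F = abs_forest H" using forest_representative by blast
    have len: "length (roots H) = p" "length (whites H) = q"
      using x F(1) H unfolding Omega_def span_basis_iff by auto
    have "permute_forest (inv s) (inv t) (?P (abs_forest K)) = abs_forest K"
      if K: "is_forest K" "length (roots K) = p" "length (whites K) = q" for K
      using K s t permutes_inv[OF s] permutes_inv[OF t]
      by (simp add: permute_abs_forest is_forest_permute permute_cforest_inverse)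
    from this[OF H(1) len] this[OF G] F(2) H(2) show ?thesis by metis
  qed
  have "Poly_Mapping.lookup (linear_ext (\<lambda>F. basis (?P F)) x) (?P (abs_forest G)) =
      (\<Sum>F\<in>Poly_Mapping.keys x. if F = abs_forest G then Poly_Mapping.lookup x F else 0)"
    unfolding linear_ext_def lookup_sum lookup_scale lookup_basis
    using inj by (intro sum.cong refl) auto
  also have "\<dots> = Poly_Mapping.lookup x (abs_forest G)" by (simp add: in_keys_iff)
  finally have "of_int (sign s * sign t) * Poly_Mapping.lookup x (?P (abs_forest G)) =
      Poly_Mapping.lookup x (abs_forest G)"
    using x s t by (simp add: Omega_def lookup_scale)
  then have "of_int ((sign s * sign t) * (sign s * sign t)) * Poly_Mapping.lookup x (?P (abs_forest G)) =
      of_int (sign s * sign t) * Poly_Mapping.lookup x (abs_forest G)"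
    by (metis (no_types, lifting) mult.assoc of_int_mult)
  moreover have "(sign s * sign t) * (sign s * sign t) = 1"
    by (simp add: sign_def)
  ultimately show ?thesis using G s t by (simp add: permute_abs_forest)
qed

text \<open>Permuting is a bijection from the class of \<open>G\<close> to that of the permuted
  forest, so the denominators agree.\<close>

lemma antisymmetric_density:
  assumes x: "x \<in> Omega p q"
  shows "antisymmetric p q (density M x)"
  unfolding antisymmetric_def
proof (intro allI impI)
  fix G and s t :: "nat \<Rightarrow> nat"
  assume G: "is_forest G" "length (roots G) = p" "length (whites G) = q"
    and s: "s permutes {..<p}" and t: "t permutes {..<q}"
  let ?G = "permute_cforest s t G"
  have abs: "abs_forest (permute_cforest s t H) = abs_forest ?G" if "H \<in> cforests M p q" "abs_forest H = abs_forest G" for H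
    using that G s t permute_abs_forest[of H s t] permute_abs_forest[of G s t]
    by (simp add: cforestsD)
  have abs': "abs_forest (permute_cforest (inv s) (inv t) H) = abs_forest G"
    if "H \<in> cforests M p q" "abs_forest H = abs_forest ?G" for H
    using that G s t permute_abs_forest[of H "inv s" "inv t"] permute_abs_forest[of ?G "inv s" "inv t"]
      permutes_inv[OF s] permutes_inv[OF t] is_forest_permute[of G s t]
    by (simp add: cforestsD permute_cforest_inverse)
  have "bij_betw (permute_cforest s t) {H \<in> cforests M p q. abs_forest H = abs_forest G}
      {H \<in> cforests M p q. abs_forest H = abs_forest ?G}"
    using permute_cforests[OF s t] permute_cforests[OF permutes_inv[OF s] permutes_inv[OF t]] abs abs'
    by (intro bij_betw_byWitness[of _ "permute_cforest (inv s) (inv t)"])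
      (auto simp: permute_cforest_inverse s t cforestsD)
  from bij_betw_same_card[OF this] Omega_lookup_permute[OF x s t G]
  show "density M x ?G = of_int (sign s * sign t) * density M x G"
    using G unfolding density_def by simp
qed

lemma Omega_realize:
  assumes "x \<in> Omega p q"
  shows "\<exists>M. realize M p q (density M x) = x"
proof -
  let ?M = "Max (insert 0 (num_verts ` Poly_Mapping.keys x))"
  have "num_verts F \<le> ?M" if "F \<in> Poly_Mapping.keys x" for F using that by simp
  then show ?thesis using realize_density[OF assms] by blast
qed

section \<open>The differentials on functions on representatives\<close>

text \<open>Inverse to \<open>add_edge\<close>, which consumes the last root; hence \<open>x\<close>
  goes to the end of the list.\<close>

definition cut :: "cforest \<Rightarrow> nat \<Rightarrow> cforest" where
  "cut H x = CForest (nverts H) (del_edge (edges H) x) (roots H @ [x]) (whites H)"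

lemma is_forest_cut:
  assumes "is_forest H" "x \<in> Domain (edges H)"
  shows "is_forest (cut H x)"
  using assms by (auto simp: is_forest_iff cut_def del_edge_def single_valued_def)

lemma cut_add_edge:
  assumes "is_forest G" "roots G \<noteq> []"
  shows "cut (add_edge G v) (last (roots G)) = G"
proof -
  have "last (roots G) \<in> set (roots G)" using assms(2) by simp
  then have "last (roots G) \<notin> Domain (edges G)" using assms(1) by (auto simp: is_forest_iff)
  then have "del_edge (insert (last (roots G), v) (edges G)) (last (roots G)) = edges G"
    by (auto simp: del_edge_def)
  then show ?thesis using assms(2) by (simp add: cut_def add_edge_def)
qed

lemma add_edge_cut:
  assumes "is_forest H" "(x, v) \<in> edges H"
  shows "add_edge (cut H x) v = H"
proof -
  have "insert (x, v) (del_edge (edges H) x) = edges H"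
    using assms by (auto simp: del_edge_def is_forest_iff single_valued_def)
  then show ?thesis by (simp add: cut_def add_edge_def)
qed

lemma dH_abs_forest:
  assumes "is_forest G"
  shows "dH_forest (abs_forest G) =
    (if roots G = [] then 0 else \<Sum>v<nverts G. basis (abs_forest (add_edge G v)))"
  using assms forest_iso_refl by (simp add: dH_forest.abs_eq)

text \<open>Pairs of a forest and a target correspond to pairs of a forest and a vertex with an
  outgoing edge, through \<open>add_edge\<close> and \<open>cut\<close>. As vertices are numbered,
  no automorphisms enter.\<close>

lemma dH_realize:
  "dH (realize M (Suc p) q u) = realize M p q (\<lambda>H. \<Sum>x\<in>Domain (edges H). u (cut H x))"
proof -
  let ?C = "cforests M (Suc p) q" and ?C' = "cforests M p q"
  let ?i = "\<lambda>(H, x). (cut H x, THE v. (x, v) \<in> edges H)"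
  let ?j = "\<lambda>(G, v). (add_edge G v, last (roots G))"
  have the: "(x, THE v. (x, v) \<in> edges H) \<in> edges H" if "H \<in> ?C'" "x \<in> Domain (edges H)" for H x
  proof (rule theI')
    have "single_valued (edges H)" using cforestsD(1)[OF that(1)] by (simp add: is_forest_iff)
    then show "\<exists>!v. (x, v) \<in> edges H" using that(2) by (blast dest: single_valuedD)
  qed
  have fin: "finite (Domain (edges H))" if "H \<in> ?C'" for H
  proof -
    have "Domain (edges H) \<subseteq> {..<nverts H}" using cforestsD(1)[OF that] by (auto simp: is_forest_iff)
    then show ?thesis using finite_subset by blast
  qed
  have ne: "roots G \<noteq> []" if "G \<in> ?C" for G using cforestsD(3)[OF that] by auto
  have "dH (realize M (Suc p) q u) =
      (\<Sum>G\<in>?C. \<Sum>v<nverts G. scale (u G) (basis (abs_forest (add_edge G v))))"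
    unfolding dH_def linear_ext_realize using ne
    by (intro sum.cong refl) (simp add: dH_abs_forest cforestsD fs.scale_sum_right)
  also have "\<dots> = (\<Sum>(G, v)\<in>(SIGMA G:?C. {..<nverts G}). scale (u G) (basis (abs_forest (add_edge G v))))"
    by (rule sum.Sigma) auto
  also have "\<dots> = (\<Sum>(H, x)\<in>(SIGMA H:?C'. Domain (edges H)). scale (u (cut H x)) (basis (abs_forest H)))"
  proof (rule sum.reindex_bij_witness[of _ ?i ?j])
    fix a assume "a \<in> (SIGMA G:?C. {..<nverts G})"
    then obtain G v where a: "a = (G, v)" "G \<in> ?C" "v < nverts G" by auto
    have r: "last (roots G) \<notin> Domain (edges G)"
      using last_in_set[OF ne[OF a(2)]] cforestsD(1)[OF a(2)] by (auto simp: is_forest_iff)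
    have "(THE w. (last (roots G), w) \<in> edges (add_edge G v)) = v"
      using r by (intro the_equality) (auto simp: add_edge_def)
    then show "?i (?j a) = a" using a ne by (simp add: cut_add_edge cforestsD)
    have "add_edge G v \<in> ?C'"
      using is_forest_add_edge[OF cforestsD(1)[OF a(2)] ne[OF a(2)] a(3)] cforestsD[OF a(2)]
      by (auto simp: cforests_def add_edge_def)
    then show "?j a \<in> (SIGMA H:?C'. Domain (edges H))" using a by (auto simp: add_edge_def)
    show "(case ?j a of (H, x) \<Rightarrow> scale (u (cut H x)) (basis (abs_forest H))) =
        (case a of (G, v) \<Rightarrow> scale (u G) (basis (abs_forest (add_edge G v))))"
      using a ne by (simp add: cut_add_edge cforestsD)
  next
    fix b assume "b \<in> (SIGMA H:?C'. Domain (edges H))"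
    then obtain H x where b: "b = (H, x)" "H \<in> ?C'" "x \<in> Domain (edges H)" by auto
    note H = cforestsD[OF b(2)]
    show "?j (?i b) = b"
      using b add_edge_cut[OF H(1) the[OF b(2,3)]] by (simp add: cut_def)
    have "cut H x \<in> ?C" using is_forest_cut[OF H(1) b(3)] H by (simp add: cforests_def cut_def)
    moreover have "(THE v. (x, v) \<in> edges H) < nverts H"
      using the[OF b(2,3)] H(1) by (auto simp: is_forest_iff)
    ultimately show "?i b \<in> (SIGMA G:?C. {..<nverts G})" using b by (simp add: cut_def)
  qed
  also have "\<dots> = (\<Sum>H\<in>?C'. \<Sum>x\<in>Domain (edges H). scale (u (cut H x)) (basis (abs_forest H)))"
    using fin by (intro sum.Sigma[symmetric]) auto
  also have "\<dots> = realize M p q (\<lambda>H. \<Sum>x\<in>Domain (edges H). u (cut H x))"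
    unfolding realize_def fs.scale_sum_left ..
  finally show ?thesis .
qed

lemma cut_oriented:
  fixes \<phi> :: "nat \<Rightarrow> (nat \<times> nat) set \<Rightarrow> nat set \<Rightarrow> 'k::field_char_0"
  assumes H: "is_forest H"
  shows "(\<Sum>x\<in>Domain (edges H). oriented \<phi> (cut H x)) =
    oriented (\<lambda>n E W. detach n (\<lambda>E'. \<phi> n E' W) E) H"
proof -
  have "list_sign (roots H @ [x]) =
      list_sign (roots H) * (eps x (root_set (nverts H) (edges H)) :: 'k)"
    if "x \<in> Domain (edges H)" for x
    using list_sign_snoc[of "roots H" x] H that by (auto simp: is_forest_iff simp flip: set_roots)
  then show ?thesis
    unfolding oriented_def detach_def sum_distrib_left
    by (intro sum.cong refl) (simp add: cut_def)
qed

lemma dH_oriented: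
  "dH (realize M (Suc p) q (oriented \<phi>)) =
     realize M p q (oriented (\<lambda>n E W. detach n (\<lambda>E'. \<phi> n E' W) E))"
  unfolding dH_realize by (intro realize_cong) (simp add: cut_oriented cforestsD)

section \<open>The vertical differential on representatives\<close>

definition uncolour :: "cforest \<Rightarrow> cforest" where
  "uncolour H = CForest (nverts H) (edges H) (roots H) (butlast (whites H))"

lemma whiten_abs_forest:
  assumes "is_forest G"
  shows "whiten_forest (abs_forest G) =
    (\<Sum>b\<in>{..<nverts G} - set (whites G). basis (abs_forest (whiten G b)))"
  using assms forest_iso_refl by (simp add: whiten_forest.abs_eq)

lemma is_forest_uncolour: "is_forest H \<Longrightarrow> is_forest (uncolour H)"
  by (auto simp: is_forest_iff uncolour_def distinct_butlast dest: in_set_butlastD)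

lemma is_forest_whiten:
  "is_forest G \<Longrightarrow> b \<in> {..<nverts G} - set (whites G) \<Longrightarrow> is_forest (whiten G b)"
  by (auto simp: is_forest_iff whiten_def)

text \<open>A representative with \<open>q + 1\<close> white vertices arises by whitening in exactly
  one way, from the forest in which its last white vertex is black; hence there is no sum on the
  right.\<close>

lemma whiten_realize:
  "linear_ext whiten_forest (realize M p q u) = realize M p (Suc q) (\<lambda>H. u (uncolour H))"
proof -
  let ?C = "cforests M p q" and ?C' = "cforests M p (Suc q)"
  let ?B = "\<lambda>G. {..<nverts G} - set (whites G)"
  let ?i = "\<lambda>H. (uncolour H, last (whites H))"
  have "linear_ext whiten_forest (realize M p q u) =
      (\<Sum>G\<in>?C. \<Sum>b\<in>?B G. scale (u G) (basis (abs_forest (whiten G b))))"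
    unfolding linear_ext_realize
    by (intro sum.cong refl) (simp add: whiten_abs_forest cforestsD fs.scale_sum_right)
  also have "\<dots> = (\<Sum>(G, b)\<in>(SIGMA G:?C. ?B G). scale (u G) (basis (abs_forest (whiten G b))))"
    by (rule sum.Sigma) auto
  also have "\<dots> = realize M p (Suc q) (\<lambda>H. u (uncolour H))"
    unfolding realize_def
  proof (rule sum.reindex_bij_witness[of _ ?i "\<lambda>(G, b). whiten G b"])
    fix a assume "a \<in> (SIGMA G:?C. ?B G)"
    then obtain G b where a: "a = (G, b)" "G \<in> ?C" "b \<in> ?B G" by auto
    show "?i (case a of (G, b) \<Rightarrow> whiten G b) = a"
      using a by (simp add: uncolour_def whiten_def)
    show "(case a of (G, b) \<Rightarrow> whiten G b) \<in> ?C'"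
      using a is_forest_whiten[OF cforestsD(1)[OF a(2)] a(3)] cforestsD[OF a(2)]
      by (simp add: cforests_def whiten_def)
    show "scale (u (uncolour (case a of (G, b) \<Rightarrow> whiten G b)))
        (basis (abs_forest (case a of (G, b) \<Rightarrow> whiten G b))) =
      (case a of (G, b) \<Rightarrow> scale (u G) (basis (abs_forest (whiten G b))))"
      using a by (simp add: uncolour_def whiten_def)
  next
    fix H assume "H \<in> ?C'"
    note H = cforestsD[OF this]
    have ne: "whites H \<noteq> []" using H(4) by auto
    show "(case ?i H of (G, b) \<Rightarrow> whiten G b) = H"
      using ne by (simp add: uncolour_def whiten_def)
    have "last (whites H) \<in> ?B (uncolour H)"
      using ne H(1) by (cases "whites H" rule: rev_cases) (auto simp: uncolour_def is_forest_iff)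
    then show "?i H \<in> (SIGMA G:?C. ?B G)"
      using H is_forest_uncolour[OF H(1)] by (simp add: cforests_def uncolour_def)
  qed
  finally show ?thesis .
qed

definition skew_uncolour :: "(cforest \<Rightarrow> 'k) \<Rightarrow> cforest \<Rightarrow> 'k::field_char_0" where
  "skew_uncolour u H = 1 / fact (length (whites H)) *
     (\<Sum>t | t permutes {..<length (whites H)}. of_int (sign t) * u (uncolour (permute_cforest id t H)))"

lemma dV_realize: "dV (realize M p q u) = realize M p (Suc q) (skew_uncolour u)"
proof -
  let ?C = "cforests M p (Suc q)" and ?w = "\<lambda>H. u (uncolour H)"
  let ?T = "{t. t permutes {..<Suc q}}"
  have "dV (realize M p q u) = (\<Sum>H\<in>?C. scale (?w H) (scale (1 / fact (Suc q))
      (\<Sum>t\<in>?T. scale (of_int (sign t)) (basis (permute_forest id t (abs_forest H))))))"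
    unfolding dV_def whiten_realize unfolding linear_ext_realize
    by (intro sum.cong refl) (simp only: skew_whites_def num_abs_forest cforestsD)
  also have "\<dots> = scale (1 / fact (Suc q)) (\<Sum>H\<in>?C. \<Sum>t\<in>?T.
      scale (of_int (sign t)) (scale (?w H) (basis (permute_forest id t (abs_forest H)))))"
    by (simp add: fs.scale_sum_right mult_ac)
  also have "\<dots> = scale (1 / fact (Suc q)) (\<Sum>t\<in>?T. scale (of_int (sign t))
      (linear_ext (\<lambda>F. basis (permute_forest id t F)) (realize M p (Suc q) ?w)))"
    by (subst sum.swap) (simp add: linear_ext_realize fs.scale_sum_right)
  also have "\<dots> = scale (1 / fact (Suc q)) (\<Sum>t\<in>?T. scale (of_int (sign t))
      (realize M p (Suc q) (\<lambda>H. ?w (permute_cforest id (inv t) H))))"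
    by (intro arg_cong[where f = "scale _"] sum.cong refl)
      (use permute_realize[OF permutes_id] in simp)
  also have "\<dots> = realize M p (Suc q) (\<lambda>H. 1 / fact (Suc q) *
      (\<Sum>t\<in>?T. of_int (sign t) * ?w (permute_cforest id (inv t) H)))"
    by (simp only: realize_scale realize_sum)
  also have "\<dots> = realize M p (Suc q) (skew_uncolour u)"
  proof (rule realize_cong)
    fix H assume "H \<in> ?C"
    moreover have "(\<Sum>t\<in>?T. of_int (sign t) * ?w (permute_cforest id (inv t) H)) =
        (\<Sum>t\<in>?T. of_int (sign t) * ?w (permute_cforest id t H))"
      by (subst (2) sum_permutations_inverse, intro sum.cong refl)
        (auto simp: sign_inverse permutes_lessThan_permutation)
    ultimately show "1 / fact (Suc q) * (\<Sum>t\<in>?T. of_int (sign t) * ?w (permute_cforest id (inv t) H)) =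
        skew_uncolour u H"
      by (simp only: skew_uncolour_def cforestsD)
  qed
  finally show ?thesis .
qed

text \<open>A permutation of \<open>q + 1\<close> points is a permutation of the first
  \<open>q\<close> followed by the transposition of \<open>q\<close> and \<open>t q\<close>; so each
  value of \<open>t q\<close> occurs \<open>fact q\<close> times.\<close>

lemma sum_permutations_last:
  fixes g :: "nat \<Rightarrow> 'a::field_char_0"
  shows "(\<Sum>t | t permutes {..<Suc q}. g (t q)) = fact q * (\<Sum>j<Suc q. g j)"
proof -
  have "(\<Sum>t | t permutes {..<Suc q}. g (t q)) =
      (\<Sum>j\<in>insert q {..<q}. \<Sum>s | s permutes {..<q}. g ((transpose q j \<circ> s) q))"
    unfolding lessThan_Suc by (rule sum_over_permutations_insert) auto
  also have "\<dots> = (\<Sum>j\<in>insert q {..<q}. \<Sum>s | s permutes {..<q}. g j)"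
    by (intro sum.cong refl) (simp add: permutes_not_in)
  also have "\<dots> = fact q * (\<Sum>j<Suc q. g j)"
    by (simp add: card_permutations[OF card_lessThan] sum_distrib_left lessThan_Suc algebra_simps)
  finally show ?thesis .
qed

text \<open>The summand of \<open>t\<close> depends only on the vertex \<open>whites H ! t q\<close>
  that loses its label, since the sign of \<open>t\<close> is absorbed by that of the list. Each
  vertex occurs \<open>fact q\<close> times, which against \<open>fact (Suc q)\<close> leaves the
  factor \<open>1 / (q + 1)\<close>.\<close>

lemma skew_uncolour_oriented:
  fixes \<phi> :: "nat \<Rightarrow> (nat \<times> nat) set \<Rightarrow> nat set \<Rightarrow> 'a::field_char_0"
  assumes H: "is_forest H" "length (whites H) = Suc q"
  shows "skew_uncolour (oriented \<phi>) H =
    oriented (\<lambda>n E W. blacken (\<phi> n E) W / of_nat (Suc q)) H"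
proof -
  let ?ws = "whites H" and ?c = "list_sign (roots H) * list_sign (whites H) :: 'a"
  let ?W = "set ?ws"
  let ?f = "\<lambda>w. eps w (?W - {w}) * \<phi> (nverts H) (edges H) (?W - {w}) :: 'a"
  have d: "distinct ?ws" using H by (simp add: is_forest_iff)
  have "of_int (sign t) * oriented \<phi> (uncolour (permute_cforest id t H)) = ?c * ?f (?ws ! t q)"
    if t: "t permutes {..<Suc q}" for t
  proof -
    let ?ys = "permute_list t ?ws" and ?w = "?ws ! t q"
    have ys: "distinct ?ys" "set ?ys = ?W" "length ?ys = Suc q" using t d H by auto
    then have ne: "?ys \<noteq> []" by auto
    have "last ?ys = ?w" using ys(3) H t by (simp add: last_conv_nth[OF ne] permute_list_nth)
    then have split: "?ys = butlast ?ys @ [?w]" using append_butlast_last_id[OF ne] by simp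
    with ys have dd: "distinct (butlast ?ys @ [?w])" and "set (butlast ?ys @ [?w]) = ?W" by metis+
    then have set: "set (butlast ?ys) = ?W - {?w}" by auto
    let ?b = "list_sign (butlast ?ys) :: 'a" and ?e = "eps ?w (?W - {?w}) :: 'a"
    \<comment> \<open>The sign of the permuted list, computed once from \<open>t\<close> and once by
      splitting off its last entry.\<close>
    have "of_int (sign t) * list_sign ?ws = ?b * ?e"
      using list_sign_permute[OF d, of t, where ?'a = 'a] list_sign_snoc[OF dd, where ?'a = 'a]
        t H set split by simp
    note signs = this
    have "of_int (sign t) * ?b = of_int (sign t) * (?b * ?e) * ?e"
      using eps_square[of ?w "?W - {?w}", where ?'a = 'a] by (simp add: mult.assoc)
    also have "\<dots> = of_int (sign t) * (of_int (sign t) * list_sign ?ws) * ?e" by (simp only: signs)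
    also have "\<dots> = list_sign ?ws * ?e" by (simp flip: mult.assoc of_int_mult)
    finally have "of_int (sign t) * ?b = list_sign ?ws * ?e" .
    moreover have "of_int (sign t) * oriented \<phi> (uncolour (permute_cforest id t H)) =
        list_sign (roots H) * (of_int (sign t) * ?b) * \<phi> (nverts H) (edges H) (?W - {?w})"
      by (simp add: oriented_def uncolour_def set)
    ultimately show ?thesis by (simp add: mult.assoc)
  qed
  then have "skew_uncolour (oriented \<phi>) H =
      1 / fact (Suc q) * (\<Sum>t | t permutes {..<Suc q}. ?c * ?f (?ws ! t q))"
    unfolding skew_uncolour_def H(2) by simp
  also have "\<dots> = 1 / fact (Suc q) * (fact q * (\<Sum>j<Suc q. ?c * ?f (?ws ! j)))"
    using sum_permutations_last[of "\<lambda>j. ?c * ?f (?ws ! j)" q] by simp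
  also have "(\<Sum>j<Suc q. ?c * ?f (?ws ! j)) = (\<Sum>w\<in>?W. ?c * ?f w)"
    using sum.reindex_bij_betw[OF bij_betw_nth[OF d refl refl], of "\<lambda>w. ?c * ?f w"] H(2) by simp
  also have "\<dots> = ?c * blacken (\<phi> (nverts H) (edges H)) ?W"
    by (simp add: blacken_def sum_distrib_left)
  finally show ?thesis by (simp add: oriented_def[of _ H] field_simps del: of_nat_Suc)
qed

lemma dV_oriented:
  "dV (realize M p q (oriented \<phi>)) =
     realize M p (Suc q) (oriented (\<lambda>n E W. blacken (\<phi> n E) W / of_nat (Suc q)))"
  unfolding dV_realize by (intro realize_cong) (simp add: skew_uncolour_oriented cforestsD del: of_nat_Suc)

section \<open>Isomorphism invariant functions\<close>

text \<open>For such functions a vanishing chain of classes forces vanishing on every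
  representative; in general, values within a class may cancel.\<close>

definition iso_invariant :: "(cforest \<Rightarrow> 'k) \<Rightarrow> bool" where
  "iso_invariant u \<longleftrightarrow> (\<forall>G H. is_forest G \<longrightarrow> is_forest H \<longrightarrow> forest_iso G H \<longrightarrow> u G = u H)"

lemma iso_invariant_density: "iso_invariant (density M x)"
  unfolding iso_invariant_def using density_iso by blast

text \<open>Needed to read the cycle condition pointwise: an isomorphism \<open>f\<close> matches
  the summand at \<open>x\<close> with that at \<open>f x\<close>.\<close>

lemma iso_invariant_cut:
  assumes u: "iso_invariant u"
  shows "iso_invariant (\<lambda>H. \<Sum>x\<in>Domain (edges H). u (cut H x))"
  unfolding iso_invariant_def
proof (intro allI impI)
  fix G H assume GH: "is_forest G" "is_forest H" "forest_iso G H"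
  then obtain f where f: "bij_betw f {..<nverts G} {..<nverts H}"
    "edges H = map_prod f f ` edges G" "roots H = map f (roots G)" "whites H = map f (whites G)"
    unfolding forest_iso_def by blast
  have D: "Domain (edges G) \<subseteq> {..<nverts G}" and E: "edges G \<subseteq> {..<nverts G} \<times> {..<nverts G}"
    using GH(1) by (auto simp: is_forest_iff)
  have inj: "inj_on f {..<nverts G}" using f(1) by (simp add: bij_betw_def)
  have D': "Domain (edges H) = f ` Domain (edges G)" unfolding f(2) by (force simp: Domain.simps)
  have "u (cut H (f x)) = u (cut G x)" if x: "x \<in> Domain (edges G)" for x
  proof -
    have "del_edge (map_prod f f ` edges G) (f x) = map_prod f f ` del_edge (edges G) x"
    proof
      show "del_edge (map_prod f f ` edges G) (f x) \<subseteq> map_prod f f ` del_edge (edges G) x"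
        by (auto simp: del_edge_def)
      show "map_prod f f ` del_edge (edges G) x \<subseteq> del_edge (map_prod f f ` edges G) (f x)"
        using inj x D E unfolding del_edge_def by (fastforce dest: inj_onD)
    qed
    then have "forest_iso (cut G x) (cut H (f x))"
      unfolding forest_iso_def using f by (intro exI[of _ f]) (simp add: cut_def)
    moreover have "is_forest (cut G x)" "is_forest (cut H (f x))"
      using GH x D' by (simp_all add: is_forest_cut)
    ultimately show ?thesis using u unfolding iso_invariant_def by metis
  qed
  then show "(\<Sum>x\<in>Domain (edges G). u (cut G x)) = (\<Sum>x\<in>Domain (edges H). u (cut H x))"
    unfolding D' using inj_on_subset[OF inj D] by (simp add: sum.reindex)
qed

lemma iso_invariant_skew_uncolour:
  assumes u: "iso_invariant u"
  shows "iso_invariant (skew_uncolour u)"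
  unfolding iso_invariant_def
proof (intro allI impI)
  fix G H assume GH: "is_forest G" "is_forest H" "forest_iso G H"
  then obtain f where f: "bij_betw f {..<nverts G} {..<nverts H}"
    "edges H = map_prod f f ` edges G" "roots H = map f (roots G)" "whites H = map f (whites G)"
    unfolding forest_iso_def by blast
  have "u (uncolour (permute_cforest id t G)) = u (uncolour (permute_cforest id t H))"
    if t: "t permutes {..<length (whites G)}" for t
  proof -
    have "forest_iso (uncolour (permute_cforest id t G)) (uncolour (permute_cforest id t H))"
      unfolding forest_iso_def using f t
      by (intro exI[of _ f]) (auto simp: uncolour_def permute_list_map map_butlast)
    moreover have "is_forest (uncolour (permute_cforest id t K))"
      if "is_forest K" "length (whites K) = length (whites G)" for K
      using that t by (intro is_forest_uncolour is_forest_permute) (auto simp: permutes_id)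
    ultimately show ?thesis using u GH f(4) unfolding iso_invariant_def by simp
  qed
  then show "skew_uncolour u G = skew_uncolour u H"
    using f(4) by (simp add: skew_uncolour_def)
qed

lemma realize_iso_invariant_zero:
  assumes w: "iso_invariant w" and G: "G \<in> cforests M p q"
    and 0: "Poly_Mapping.lookup (realize M p q w) (abs_forest G) = 0"
  shows "w G = 0"
proof -
  let ?C = "{H \<in> cforests M p q. abs_forest H = abs_forest G}"
  have "w H = w G" if "H \<in> cforests M p q" "abs_forest H = abs_forest G" for H
    using that abs_forest_eq_iff[of H G] w G by (auto simp: iso_invariant_def cforestsD)
  then have "Poly_Mapping.lookup (realize M p q w) (abs_forest G) = of_nat (card ?C) * w G"
    by (rule lookup_realize_invariant)
  moreover have "G \<in> ?C" "finite ?C" using G by auto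
  then have "card ?C \<noteq> 0" by (metis card_0_eq empty_iff)
  ultimately show ?thesis using 0 by simp
qed

lemma standardize_in_cforests:
  assumes "0 < n" "n \<le> M" "valid_edges b n E" "W \<subseteq> {..<n}"
    "card (root_set n E) = p" "card W = q"
  shows "standardize n E W \<in> cforests M p q"
  using is_forest_standardize[OF assms(1,3,4)] assms(2,5,6)
  by (simp add: cforests_def standardize_def)

section \<open>Exactness\<close>

text \<open>True \<open>b\<close> is the full complex, false \<open>b\<close> the one modulo loops.
  The latter can be solved on loopless forests alone because deleting an edge creates no loop; it
  leaves out the one-vertex forests, where a lone root is a cycle but no boundary.\<close>

lemma dH_exact:
  fixes x :: "'k::field_char_0 fspace"
  assumes x: "x \<in> Omega (Suc p) q"
    and cyc: "\<And>F. b \<or> \<not> has_loop F \<Longrightarrow> Poly_Mapping.lookup (dH x) F = 0"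
  shows "\<exists>z\<in>Omega (Suc (Suc p)) q. \<forall>F. b \<or> \<not> has_loop F \<and> num_verts F \<noteq> 1 \<longrightarrow>
    Poly_Mapping.lookup x F = Poly_Mapping.lookup (dH z) F"
proof -
  obtain M where M: "realize M (Suc p) q (density M x) = x" using Omega_realize[OF x] by blast
  define u where "u = density M x"
  define \<phi> where "\<phi> = (\<lambda>n E W. u (standardize n E W))"
  have u: "iso_invariant u" "antisymmetric (Suc p) q u"
    using iso_invariant_density antisymmetric_density[OF x] by (auto simp: u_def)
  have u\<phi>: "u G = oriented \<phi> G"
    if "is_forest G" "length (roots G) = Suc p" "length (whites G) = q" for G
    using antisymmetric_eq_oriented[OF u(2) that] by (simp add: \<phi>_def)
  have x\<phi>: "x = realize M (Suc p) q (oriented \<phi>)"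
    using M u\<phi> realize_cong[of M "Suc p" q u "oriented \<phi>"] by (simp add: cforestsD u_def)
  let ?good = "\<lambda>n W. 0 < n \<and> n \<le> M \<and> W \<subseteq> {..<n} \<and> card W = q \<and> (b \<or> n \<noteq> 1)"
  \<comment> \<open>The equation is solved separately for each number of vertices and each set of
    white vertices; the guard inside makes the choice of \<open>\<Psi>\<close> total.\<close>
  have "\<exists>\<psi>. ?good n W \<longrightarrow> (\<forall>E. valid_edges b n E \<longrightarrow> card (root_set n E) = Suc p \<longrightarrow>
      detach n \<psi> E = \<phi> n E W)" for n W
  proof (cases "?good n W")
    case True
    \<comment> \<open>Extension by zero: \<open>detach_exact\<close> asks for a cycle on forests
      with any number of roots. Deleting an edge adds exactly one root, so the degrees do not
      mix.\<close>
    define \<phi>' where "\<phi>' = (\<lambda>E. if card (root_set n E) = Suc p then \<phi> n E W else 0)"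
    have "detach n \<phi>' E = 0" if E: "valid_edges b n E" for E
    proof (cases "card (root_set n E) = p")
      case p: True
      let ?H = "standardize n E W"
      have H: "?H \<in> cforests M p q" using True E p by (intro standardize_in_cforests[of n M b]) auto
      have loop: "b \<or> \<not> has_loop (abs_forest ?H)"
        using E cforestsD(1)[OF H] by (auto simp: valid_edges_def standardize_def)
      have "dH x = realize M p q (\<lambda>H. \<Sum>x\<in>Domain (edges H). u (cut H x))"
        unfolding dH_realize[symmetric] using M by (simp add: u_def)
      \<comment> \<open>The boundary of the density is isomorphism invariant, so its vanishing on a
        class is pointwise.\<close>
      then have "0 = (\<Sum>x\<in>Domain (edges ?H). u (cut ?H x))"
        using realize_iso_invariant_zero[OF iso_invariant_cut[OF u(1)] H] cyc[OF loop] by simp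
      also have "\<dots> = (\<Sum>x\<in>Domain (edges ?H). oriented \<phi> (cut ?H x))"
        using cforestsD[OF H] by (intro sum.cong refl u\<phi> is_forest_cut) (simp_all add: cut_def)
      also have "\<dots> = detach n (\<lambda>E. \<phi> n E W) E"
        using True finite_subset[of W "{..<n}"]
        by (simp add: cut_oriented[OF cforestsD(1)[OF H]] oriented_standardize)
      also have "\<dots> = detach n \<phi>' E"
        unfolding detach_def
      proof (intro sum.cong refl)
        fix y assume y: "y \<in> Domain E"
        then have "y \<notin> root_set n E" by (simp add: root_set_def)
        then show "eps y (root_set n E) * \<phi> n (del_edge E y) W = eps y (root_set n E) * \<phi>' (del_edge E y)"
          using p root_set_del_edge[OF E y] by (simp add: \<phi>'_def)
      qed
      finally show ?thesis by simp
    next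
      case p: False
      have "\<phi>' (del_edge E y) = 0" if y: "y \<in> Domain E" for y
      proof -
        have "y \<notin> root_set n E" using y by (simp add: root_set_def)
        then show ?thesis using p root_set_del_edge[OF E y] by (simp add: \<phi>'_def)
      qed
      then show ?thesis by (simp add: detach_def)
    qed
    then obtain \<psi> where \<psi>: "\<forall>E. valid_edges b n E \<longrightarrow> root_set n E \<noteq> {} \<longrightarrow> detach n \<psi> E = \<phi>' E"
      using detach_exact[of b n \<phi>'] True by blast
    have "detach n \<psi> E = \<phi> n E W" if "valid_edges b n E" "card (root_set n E) = Suc p" for E
    proof -
      have "root_set n E \<noteq> {}" using that(2) by auto
      then show ?thesis using \<psi> that by (simp add: \<phi>'_def)
    qed
    then show ?thesis by blast
  qed blast
  then obtain \<Psi> where \<Psi>: "\<And>n W E. ?good n W \<Longrightarrow> valid_edges b n E \<Longrightarrow>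
      card (root_set n E) = Suc p \<Longrightarrow> detach n (\<Psi> n W) E = \<phi> n E W"
    by metis
  let ?\<psi> = "\<lambda>n E W. \<Psi> n W E"
  let ?z = "realize M (Suc (Suc p)) q (oriented ?\<psi>)"
  have "Poly_Mapping.lookup x F = Poly_Mapping.lookup (dH ?z) F"
    if F: "b \<or> \<not> has_loop F \<and> num_verts F \<noteq> 1" for F
    unfolding x\<phi> dH_oriented lookup_realize
  proof (rule sum.cong[OF refl])
    fix G assume "G \<in> {G. G \<in> cforests M (Suc p) q \<and> abs_forest G = F}"
    then have G: "G \<in> cforests M (Suc p) q" "abs_forest G = F" by auto
    note G' = cforestsD[OF G(1)]
    have "distinct (roots G)" "distinct (whites G)" "set (whites G) \<subseteq> {..<nverts G}" "nverts G > 0"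
      using G'(1) by (auto simp: is_forest_iff)
    moreover have "valid_edges b (nverts G) (edges G)"
      using F G G' by (intro valid_edges_forest) auto
    moreover have "b \<or> nverts G \<noteq> 1" using F G G' by auto
    ultimately have "detach (nverts G) (\<Psi> (nverts G) (set (whites G))) (edges G) =
        \<phi> (nverts G) (edges G) (set (whites G))"
      using G' by (intro \<Psi>) (auto simp: distinct_card simp flip: set_roots)
    then show "oriented \<phi> G = oriented (\<lambda>n E W. detach n (\<lambda>E'. ?\<psi> n E' W) E) G"
      by (simp add: oriented_def)
  qed
  then show ?thesis using realize_in_Omega[OF antisymmetric_oriented] by blast
qed

text \<open>No forest is exceptional here, since each has a vertex 0 to contract with. Whitening
  keeps the edges, so the loopless forests can again be treated by themselves.\<close>

lemma dV_exact:
  fixes x :: "'k::field_char_0 fspace"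
  assumes x: "x \<in> Omega p q"
    and cyc: "\<And>F. b \<or> \<not> has_loop F \<Longrightarrow> Poly_Mapping.lookup (dV x) F = 0"
  shows "\<exists>y\<in>(if q = 0 then {0} else dV ` Omega p (q - 1)). \<forall>F. b \<or> \<not> has_loop F \<longrightarrow>
    Poly_Mapping.lookup x F = Poly_Mapping.lookup y F"
proof -
  obtain M where M: "realize M p q (density M x) = x" using Omega_realize[OF x] by blast
  define u where "u = density M x"
  define \<phi> where "\<phi> = (\<lambda>n E W. u (standardize n E W))"
  have u: "iso_invariant u" "antisymmetric p q u"
    using iso_invariant_density antisymmetric_density[OF x] by (auto simp: u_def)
  have u\<phi>: "u G = oriented \<phi> G"
    if "is_forest G" "length (roots G) = p" "length (whites G) = q" for G
    using antisymmetric_eq_oriented[OF u(2) that] by (simp add: \<phi>_def)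
  have x\<phi>: "x = realize M p q (oriented \<phi>)"
    using M u\<phi> realize_cong[of M p q u "oriented \<phi>"] by (simp add: cforestsD u_def)
  have dV: "dV x = realize M p (Suc q) (skew_uncolour u)"
    unfolding dV_realize[symmetric] using M by (simp add: u_def)
  define \<phi>' where "\<phi>' = (\<lambda>n E W. if card W = q then \<phi> n E W else 0)"
  define \<psi> where "\<psi> = (\<lambda>n E W. if 0 \<in> W then 0 else eps 0 W * \<phi>' n E (insert 0 W))"
  have \<psi>: "blacken (\<psi> n E) W = \<phi>' n E W"
    if n: "0 < n" "n \<le> M" and E: "valid_edges b n E" "card (root_set n E) = p" and W: "W \<subseteq> {..<n}" for n E W
    unfolding \<psi>_def
  proof (rule blacken_exact[OF _ n(1) W])
    fix W assume W: "W \<subseteq> {..<n}"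
    have fin: "finite W" using W finite_subset by blast
    show "blacken (\<phi>' n E) W = 0"
    proof (cases "card W = Suc q")
      case True
      let ?H = "standardize n E W"
      have H: "?H \<in> cforests M p (Suc q)"
        using True E n W by (intro standardize_in_cforests[of n M b]) auto
      have loop: "b \<or> \<not> has_loop (abs_forest ?H)"
        using E cforestsD(1)[OF H] by (auto simp: valid_edges_def standardize_def)
      have "0 = skew_uncolour u ?H"
        using realize_iso_invariant_zero[OF iso_invariant_skew_uncolour[OF u(1)] H] cyc[OF loop] dV
        by simp
      also have "\<dots> = skew_uncolour (oriented \<phi>) ?H"
      proof -
        have "u (uncolour (permute_cforest id t ?H)) = oriented \<phi> (uncolour (permute_cforest id t ?H))"
          if "t permutes {..<length (whites ?H)}" for t
          using that cforestsD[OF H]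
          by (intro u\<phi> is_forest_uncolour is_forest_permute) (auto simp: uncolour_def permutes_id)
        then show ?thesis by (simp add: skew_uncolour_def)
      qed
      also have "\<dots> = blacken (\<phi> n E) W / of_nat (Suc q)"
        using skew_uncolour_oriented[OF cforestsD(1,4)[OF H]] fin
        by (simp add: oriented_standardize del: of_nat_Suc)
      finally have "blacken (\<phi> n E) W = 0" by (simp del: of_nat_Suc)
      then show ?thesis using True fin by (simp add: blacken_def \<phi>'_def)
    next
      case False
      then have "card (W - {w}) \<noteq> q" if "w \<in> W" for w
        using that fin card_Suc_Diff1[OF fin that] by auto
      then show ?thesis by (simp add: blacken_def \<phi>'_def)
    qed
  qed
  have good: "blacken (\<psi> (nverts G) (edges G)) (set (whites G)) = \<phi> (nverts G) (edges G) (set (whites G))"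
    if G: "G \<in> cforests M p q" "abs_forest G = F" and F: "b \<or> \<not> has_loop F" for G F
  proof -
    note G' = cforestsD[OF G(1)]
    have "distinct (roots G)" "distinct (whites G)" "set (whites G) \<subseteq> {..<nverts G}" "nverts G > 0"
      using G'(1) by (auto simp: is_forest_iff)
    moreover have "valid_edges b (nverts G) (edges G)"
      using F G G' by (intro valid_edges_forest) auto
    ultimately show ?thesis
      using G' \<psi>[of "nverts G" "edges G" "set (whites G)"]
      by (auto simp: \<phi>'_def distinct_card simp flip: set_roots)
  qed
  show ?thesis
  proof (cases q)
    case 0
    \<comment> \<open>Without white vertices the sum in \<open>blacken\<close> is empty, so
      \<open>good\<close> gives the value zero.\<close>
    have "oriented \<phi> G = 0" if "G \<in> cforests M p q" "abs_forest G = F" "b \<or> \<not> has_loop F" for G F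
      using good[OF that] cforestsD(4)[OF that(1)] 0 by (simp add: oriented_def blacken_def)
    then have "Poly_Mapping.lookup x F = 0" if "b \<or> \<not> has_loop F" for F
      unfolding x\<phi> lookup_realize using that by (intro sum.neutral) auto
    then show ?thesis using 0 by simp
  next
    case (Suc q')
    \<comment> \<open>The factor \<open>of_nat q\<close> cancels the \<open>1 / q\<close> that the
      skew-symmetrization puts into \<open>dV\<close>.\<close>
    let ?\<psi> = "\<lambda>n E W. of_nat q * \<psi> n E W"
    let ?z = "realize M p q' (oriented ?\<psi>)"
    have bl: "blacken (\<lambda>W. of_nat q * \<psi> n E W) W = of_nat q * blacken (\<psi> n E) W" for n E W
      by (simp add: blacken_def sum_distrib_left mult_ac)
    have "q \<noteq> 0" using Suc by simp
    then have "Poly_Mapping.lookup x F = Poly_Mapping.lookup (dV ?z) F" if F: "b \<or> \<not> has_loop F" for F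
      unfolding x\<phi> dV_oriented Suc[symmetric] lookup_realize
      using good[OF _ _ F] by (intro sum.cong refl) (simp add: oriented_def bl)
    moreover have "?z \<in> Omega p q'" by (rule realize_in_Omega[OF antisymmetric_oriented])
    ultimately show ?thesis using Suc by auto
  qed
qed

section \<open>Stability of the antisymmetric chains under the differentials\<close>

lemma Omega_oriented:
  assumes "x \<in> Omega p q"
  obtains M \<phi> where "x = realize M p q (oriented \<phi>)"
proof -
  obtain M where M: "realize M p q (density M x) = x" using Omega_realize[OF assms] by blast
  have "realize M p q (density M x) =
      realize M p q (oriented (\<lambda>n E W. density M x (standardize n E W)))"
    using antisymmetric_eq_oriented[OF antisymmetric_density[OF assms]]
    by (intro realize_cong) (simp add: cforestsD)
  then show ?thesis using M that by metis
qed

lemma dH_Omega: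
  assumes "x \<in> Omega (Suc p) q"
  shows "dH x \<in> Omega p q"
proof -
  from Omega_oriented[OF assms] obtain M \<phi> where x: "x = realize M (Suc p) q (oriented \<phi>)" .
  show ?thesis unfolding x dH_oriented by (rule realize_in_Omega[OF antisymmetric_oriented])
qed

lemma dV_Omega:
  assumes "x \<in> Omega p q"
  shows "dV x \<in> Omega p (Suc q)"
proof -
  from Omega_oriented[OF assms] obtain M \<phi> where x: "x = realize M p q (oriented \<phi>)" .
  show ?thesis unfolding x dV_oriented by (rule realize_in_Omega[OF antisymmetric_oriented])
qed

section \<open>Cosets and homology\<close>

lemma dH_add: "dH (x + y) = dH x + dH y" and dV_add: "dV (x + y) = dV x + dV y"
  by (simp_all add: dH_def dV_def linear_ext_add)

lemma dH_scale: "dH (scale c x) = scale c (dH x)" and dV_scale: "dV (scale c x) = scale c (dV x)"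
  by (simp_all add: dH_def dV_def linear_ext_scale)

lemma dH_0: "dH 0 = 0" and dV_0: "dV 0 = 0"
  by (simp_all add: dH_def dV_def)

lemma subspace_image:
  assumes "fs.subspace A" "\<And>x y. d (x + y) = d x + d y" "\<And>c x. d (scale c x) = scale c (d x)"
    "d 0 = (0 :: 'k::field_char_0 fspace)"
  shows "fs.subspace (d ` A)"
proof (rule fs.subspaceI)
  show "0 \<in> d ` A" using assms(1,4) fs.subspace_0 by (metis imageI)
  show "x + y \<in> d ` A" if "x \<in> d ` A" "y \<in> d ` A" for x y
    using that fs.subspace_add[OF assms(1)] by (auto simp flip: assms(2))
  show "scale c x \<in> d ` A" if "x \<in> d ` A" for c x
    using that fs.subspace_scale[OF assms(1)] by (auto simp flip: assms(3))
qed

lemma subspace_Omega: "fs.subspace (Omega p q)"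
  unfolding Omega_def
  by (rule fs.subspaceI)
    (auto simp: linear_ext_add linear_ext_scale fs.scale_right_distrib mult.commute
      intro: fs.span_zero fs.span_add fs.span_scale)

lemma subspace_Loops: "fs.subspace (Loops p q)"
  unfolding Loops_def by (intro fs.subspace_inter subspace_Omega fs.subspace_span)

lemma Loops_iff:
  "x \<in> Loops p q \<longleftrightarrow> x \<in> Omega p q \<and> (\<forall>F. \<not> has_loop F \<longrightarrow> Poly_Mapping.lookup x F = 0)"
  by (simp add: Loops_def lookup_eq_0_if_span)

lemma coset_zero:
  assumes "fs.subspace L" "l \<in> L"
  shows "l +o L = L"
proof
  show "l +o L \<subseteq> L" using fs.subspace_add[OF assms] by (auto simp: elt_set_plus_def)
  show "L \<subseteq> l +o L"
    unfolding elt_set_plus_def using fs.subspace_diff[OF assms(1) _ assms(2)]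
    by (auto intro!: bexI[of _ "_ - l"])
qed

lemma coset_eq_iff:
  assumes "fs.subspace L"
  shows "x +o L = y +o L \<longleftrightarrow> x - y \<in> L"
proof
  assume "x +o L = y +o L"
  moreover have "x \<in> x +o L" using fs.subspace_0[OF assms] by (auto simp: elt_set_plus_def)
  ultimately show "x - y \<in> L" by (auto simp: elt_set_plus_def)
next
  assume "x - y \<in> L"
  then have "y +o ((x - y) +o L) = y +o L" using coset_zero[OF assms] by simp
  then show "x +o L = y +o L" by (simp add: set_plus_rearrange2)
qed

lemma coset_add:
  assumes "fs.subspace L"
  shows "(x +o L) + (y +o L) = (x + y) +o L"
proof -
  have "L + L = L"
    using fs.subspace_add[OF assms] fs.subspace_0[OF assms] unfolding set_plus_def
    by (force intro: bexI[of _ 0])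
  then show ?thesis by (simp add: set_plus_rearrange)
qed

text \<open>The elementwise form of an induced map agrees with the coset of \<open>d x\<close>,
  because \<open>d\<close> sends \<open>L\<close> into \<open>L'\<close>.\<close>

lemma induced_coset:
  fixes d :: "'k::field_char_0 fspace \<Rightarrow> 'k fspace"
  assumes d: "\<And>x y. d (x + y) = d x + d y" and L: "d ` L \<subseteq> L'" "0 \<in> L" "fs.subspace L'"
  shows "d ` (x +o L) + L' = d x +o L'"
proof
  show "d ` (x +o L) + L' \<subseteq> d x +o L'"
    using L(1) fs.subspace_add[OF L(3)] by (fastforce simp: set_plus_def elt_set_plus_def d add.assoc)
  have "x \<in> x +o L" using L(2) by (auto simp: elt_set_plus_def intro!: bexI[of _ 0])
  then have "d x \<in> d ` (x +o L)" by (rule imageI)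
  then show "d x +o L' \<subseteq> d ` (x +o L) + L'"
    by (auto simp: set_plus_def elt_set_plus_def)
qed

lemma homology_trivial:
  fixes B :: "'k::field_char_0 fspace set"
  assumes "fs.subspace B" "0 \<in> Z" "Z \<subseteq> B"
  shows "homology Z B = {B}"
  unfolding homology_def using assms coset_zero[OF assms(1)] by (auto intro!: image_eqI[of _ _ 0])

lemma coset_of_cosets:
  assumes "fs.subspace L"
  shows "(x +o L) +o ((\<lambda>b. b +o L) ` B) = (\<lambda>b. (x + b) +o L) ` B"
  by (auto simp: elt_set_plus_def[of _ "_ ` _"] coset_add[OF assms])

text \<open>Two ambiguities are absorbed: \<open>b\<close> by reindexing \<open>B\<close>, and an
  element of \<open>L\<close> inside each coset.\<close>

lemma coset_of_cosets_cong:
  assumes L: "fs.subspace L" and B: "fs.subspace B" and b: "b \<in> B" and l: "x - (y + b) \<in> L"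
  shows "(x +o L) +o ((\<lambda>b. b +o L) ` B) = (y +o L) +o ((\<lambda>b. b +o L) ` B)"
proof -
  have eq: "(x + a) +o L = (y + (b + a)) +o L" for a
    using l by (simp add: coset_eq_iff[OF L] algebra_simps)
  have "(\<lambda>a. (x + a) +o L) ` B = (\<lambda>a. (y + a) +o L) ` ((\<lambda>a. b + a) ` B)"
    unfolding image_image eq ..
  also have "(\<lambda>a. b + a) ` B = B"
    using coset_zero[OF B b] by (auto simp: elt_set_plus_def image_def)
  finally show ?thesis unfolding coset_of_cosets[OF L] .
qed

lemma quotient_homology_trivial:
  fixes L :: "'k::field_char_0 fspace set"
  assumes L: "fs.subspace L" and B: "fs.subspace B" and "0 \<in> Z"
    and exact: "\<And>x. x \<in> Z \<Longrightarrow> \<exists>b\<in>B. x - b \<in> L"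
  shows "homology ((\<lambda>x. x +o L) ` Z) ((\<lambda>b. b +o L) ` B) = {(\<lambda>b. b +o L) ` B}"
proof -
  have "(x +o L) +o ((\<lambda>b. b +o L) ` B) = (0 +o L) +o ((\<lambda>b. b +o L) ` B)" if x: "x \<in> Z" for x
  proof -
    obtain b where "b \<in> B" "x - b \<in> L" using exact[OF x] by blast
    then show ?thesis by (intro coset_of_cosets_cong[OF L B, of b]) simp_all
  qed
  moreover have "(0 +o L) +o ((\<lambda>b. b +o L) ` B) = (\<lambda>b. b +o L) ` B"
    unfolding coset_of_cosets[OF L] by simp
  ultimately have "(x +o L) +o ((\<lambda>b. b +o L) ` B) = (\<lambda>b. b +o L) ` B" if "x \<in> Z" for x
    using that by simp
  then show ?thesis using \<open>0 \<in> Z\<close> unfolding homology_def image_image by force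
qed

section \<open>Forests with loops\<close>

lemma linear_ext_in_span:
  assumes "\<And>F. F \<in> Poly_Mapping.keys x \<Longrightarrow> \<phi> F \<in> fs.span S"
  shows "linear_ext \<phi> x \<in> fs.span S"
  unfolding linear_ext_def using assms by (intro fs.span_sum fs.span_scale)

lemma dH_Loops:
  assumes x: "x \<in> Loops (Suc p) q"
  shows "dH x \<in> Loops p q"
proof -
  have "dH_forest F \<in> fs.span (basis ` {F. has_loop F})" if "F \<in> Poly_Mapping.keys x" for F
  proof -
    obtain G where G: "is_forest G" "F = abs_forest G" using forest_representative by blast
    have "has_loop F" using x that unfolding Loops_iff in_keys_iff by blast
    then have "has_loop (abs_forest (add_edge G v))" if "v < nverts G" "roots G \<noteq> []" for v
      using G is_forest_add_edge[OF G(1)] that by (auto simp: add_edge_def)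
    then have "(\<Sum>v<nverts G. basis (abs_forest (add_edge G v))) \<in> fs.span (basis ` {F. has_loop F})"
      if "roots G \<noteq> []"
      using that by (intro fs.span_sum fs.span_base) blast
    then show ?thesis unfolding G(2) dH_abs_forest[OF G(1)] using fs.span_zero by auto
  qed
  then have "dH x \<in> fs.span (basis ` {F. has_loop F})" unfolding dH_def by (rule linear_ext_in_span)
  then show ?thesis using x dH_Omega[of x p q] by (simp add: Loops_def)
qed

lemma dV_Loops:
  assumes x: "x \<in> Loops p q"
  shows "dV x \<in> Loops p (Suc q)"
proof -
  let ?S = "fs.span (basis ` {F. has_loop F})"
  have "whiten_forest F \<in> ?S" if "F \<in> Poly_Mapping.keys x" for F
  proof -
    obtain G where G: "is_forest G" "F = abs_forest G" using forest_representative by blast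
    have "has_loop F" using x that unfolding Loops_iff in_keys_iff by blast
    then have "has_loop (abs_forest (whiten G b))" if "b \<in> {..<nverts G} - set (whites G)" for b
      using G is_forest_whiten[OF G(1) that] by (auto simp: whiten_def)
    then show ?thesis unfolding G(2) whiten_abs_forest[OF G(1)]
      by (intro fs.span_sum fs.span_base) blast
  qed
  then have 1: "linear_ext whiten_forest x \<in> ?S" by (rule linear_ext_in_span)
  have "skew_whites F \<in> ?S" if "F \<in> Poly_Mapping.keys (linear_ext whiten_forest x)" for F
  proof -
    obtain G where G: "is_forest G" "F = abs_forest G" using forest_representative by blast
    have "has_loop F" using 1 that unfolding span_basis_iff by blast
    then have "has_loop (permute_forest id t F)" if "t permutes {..<num_whites F}" for t
      using G that by (simp add: permute_abs_forest permutes_id is_forest_permute)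
    then show ?thesis unfolding skew_whites_def
      by (intro fs.span_scale fs.span_sum fs.span_base) blast
  qed
  then have "dV x \<in> ?S" unfolding dV_def by (rule linear_ext_in_span)
  then show ?thesis using x dV_Omega[of x p q] by (simp add: Loops_def)
qed

text \<open>As \<open>dH\<close> respects \<open>Loops\<close>, a coset is a cycle iff
  \<open>dH\<close> of a representative lies in \<open>Loops\<close>. This reduces the homology of
  cosets to relative cycles and boundaries in \<open>Omega\<close>.\<close>

lemma tHH_eq:
  "(tHH (Suc p) q :: 'k::field_char_0 fspace set set set) = homology ((\<lambda>x. x +o Loops (Suc p) q) ` {x \<in> Omega (Suc p) q. dH x \<in> Loops p q})
     ((\<lambda>b. b +o Loops (Suc p) q) ` dH ` Omega (Suc (Suc p)) q)" (is ?H)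
  and tBH_eq: "(tBH p q :: 'k fspace set set) = (\<lambda>b. b +o Loops p q) ` dH ` Omega (Suc p) q"
proof -
  have td: "tdH (Suc p) q (x +o Loops (Suc p) q) = dH x +o Loops p q" for p and x :: "'k fspace"
    unfolding tdH_def diff_Suc_1 using dH_Loops
    by (intro induced_coset dH_add subspace_Loops fs.subspace_0) auto
  show tBH: "(tBH p q :: 'k fspace set set) = (\<lambda>b. b +o Loops p q) ` dH ` Omega (Suc p) q" for p
    unfolding tBH_def tOmega_def image_image by (simp add: td)
  have iff: "dH x +o Loops p q = Loops p q \<longleftrightarrow> dH x \<in> Loops p q" for x :: "'k fspace"
    using coset_eq_iff[OF subspace_Loops, of "dH x" p q 0] by simp
  have "{X \<in> tOmega (Suc p) q. tdH (Suc p) q X = Loops p q} =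
      (\<lambda>x. x +o Loops (Suc p) q) ` {x \<in> Omega (Suc p) q. dH x \<in> (Loops p q :: 'k fspace set)}"
    by (simp only: tOmega_def Compr_image_eq td iff)
  then show ?H unfolding tHH_def tBH diff_Suc_1 by simp
qed

lemma tHV_eq:
  "(tHV p q :: 'k::field_char_0 fspace set set set) = homology ((\<lambda>x. x +o Loops p q) ` {x \<in> Omega p q. dV x \<in> Loops p (Suc q)})
     ((\<lambda>b. b +o Loops p q) ` BV p q)" (is ?H)
  and tBV_eq: "(tBV p q :: 'k fspace set set) = (\<lambda>b. b +o Loops p q) ` BV p q"
proof -
  have td: "tdV p q (x +o Loops p q) = dV x +o Loops p (Suc q)" for q and x :: "'k fspace"
    unfolding tdV_def Suc_eq_plus1[symmetric] using dV_Loops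
    by (intro induced_coset dV_add subspace_Loops fs.subspace_0) auto
  show tBV: "(tBV p q :: 'k fspace set set) = (\<lambda>b. b +o Loops p q) ` BV p q" for q
    by (cases q) (simp_all add: tBV_def BV_def tOmega_def image_image td)
  have iff: "dV x +o Loops p (Suc q) = Loops p (Suc q) \<longleftrightarrow> dV x \<in> Loops p (Suc q)" for x :: "'k fspace"
    using coset_eq_iff[OF subspace_Loops, of "dV x" p "Suc q" 0] by simp
  have "{X \<in> tOmega p q. tdV p q X = Loops p (Suc q)} =
      (\<lambda>x. x +o Loops p q) ` {x \<in> Omega p q. dV x \<in> (Loops p (Suc q) :: 'k fspace set)}"
    by (simp only: tOmega_def Compr_image_eq td iff)
  then show ?H unfolding tHV_def tBV by simp
qed

section \<open>Sizes of forests and the one-vertex trees\<close>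

lemma keys_Omega:
  assumes "x \<in> Omega p q" "F \<in> Poly_Mapping.keys x"
  shows "num_trees F = p" "num_whites F = q"
  using assms unfolding Omega_def span_basis_iff by auto

lemma num_le_num_verts: "num_trees F \<le> num_verts F" "num_whites F \<le> num_verts F"
proof -
  obtain G where G: "is_forest G" "F = abs_forest G" using forest_representative by blast
  have "set (roots G) \<subseteq> {..<nverts G}" "set (whites G) \<subseteq> {..<nverts G}"
    using G(1) by (auto simp: is_forest_iff)
  then have "card (set (roots G)) \<le> card {..<nverts G}" "card (set (whites G)) \<le> card {..<nverts G}"
    by (simp_all add: card_mono del: card_lessThan)
  moreover have "distinct (roots G)" "distinct (whites G)" using G(1) by (simp_all add: is_forest_iff)
  ultimately show "num_trees F \<le> num_verts F" "num_whites F \<le> num_verts F"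
    using G by (simp_all add: distinct_card)
qed

text \<open>With one tree and at most one white vertex the identity is the only permutation, so
  antisymmetry is void; for \<open>q \<ge> 2\<close> there are no such trees and \<open>x\<close> is
  zero.\<close>

lemma one_vertex_trees_Omega:
  assumes x: "x \<in> fs.span (basis ` one_vertex_trees q)"
  shows "x \<in> Omega 1 q"
proof (cases "x = 0")
  case True
  then show ?thesis using fs.subspace_0[OF subspace_Omega] by simp
next
  case False
  have keys: "Poly_Mapping.keys x \<subseteq> one_vertex_trees q" using x by (simp add: span_basis_iff)
  then obtain F where "F \<in> one_vertex_trees q" using False by fastforce
  then have q: "q \<le> 1" using num_le_num_verts(2)[of F] by (simp add: one_vertex_trees_def)
  have id: "s = id" if "s permutes {..<n}" "n \<le> 1" for s and n :: nat
    using that by (cases n) (auto simp: permutes_empty permutes_sing lessThan_Suc)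
  have p: "permute_forest id id F = F" for F
  proof -
    obtain G where G: "is_forest G" "F = abs_forest G" using forest_representative by blast
    then show ?thesis by (simp add: permute_abs_forest permutes_id permute_cforest_def)
  qed
  have "linear_ext basis x = x" unfolding linear_ext_def by (rule eq_sum_basis[symmetric])
  then have "linear_ext (\<lambda>F. basis (permute_forest s t F)) x = scale (of_int (sign s * sign t)) x"
    if "s permutes {..<1}" "t permutes {..<q}" for s t
    using id[OF that(1)] id[OF that(2)] q p by simp
  moreover have "Poly_Mapping.keys x \<subseteq> {F. num_trees F = 1 \<and> num_whites F = q}"
    using keys by (auto simp: one_vertex_trees_def)
  ultimately show ?thesis unfolding Omega_def span_basis_iff by blast
qed

text \<open>The only edge that can be added to a single vertex is a loop, so these trees are cycles
  in the quotient.\<close>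

lemma dH_one_vertex_trees:
  assumes x: "x \<in> fs.span (basis ` one_vertex_trees q)"
  shows "dH x \<in> Loops 0 q"
proof -
  have "dH_forest F \<in> fs.span (basis ` {F. has_loop F})" if "F \<in> Poly_Mapping.keys x" for F
  proof -
    obtain G where G: "is_forest G" "F = abs_forest G" using forest_representative by blast
    have "F \<in> one_vertex_trees q" using x that unfolding span_basis_iff by blast
    then have 1: "nverts G = 1" "roots G \<noteq> []" using G by (auto simp: one_vertex_trees_def)
    moreover have "set (roots G) \<subseteq> {..<nverts G}" using G(1) by (auto simp: is_forest_iff)
    ultimately have "last (roots G) = 0" using last_in_set[OF 1(2)] by fastforce
    then have "has_loop (abs_forest (add_edge G 0))"
      using is_forest_add_edge[OF G(1) 1(2), of 0] 1(1) by (auto simp: add_edge_def)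
    then show ?thesis unfolding G(2) dH_abs_forest[OF G(1)]
      using 1 by (auto intro: fs.span_base)
  qed
  then have "dH x \<in> fs.span (basis ` {F. has_loop F})" unfolding dH_def by (rule linear_ext_in_span)
  then show ?thesis using dH_Omega[of x 0 q] one_vertex_trees_Omega[OF x] by (simp add: Loops_def)
qed

lemma dH_quotient_exact:
  assumes x: "x \<in> Omega (Suc p) q" "dH x \<in> Loops p q"
  shows "\<exists>z\<in>Omega (Suc (Suc p)) q. \<forall>F. \<not> has_loop F \<and> num_verts F \<noteq> 1 \<longrightarrow>
    Poly_Mapping.lookup (x - dH z) F = 0"
  using dH_exact[OF x(1), of False] x(2) unfolding Loops_iff by (fastforce simp: lookup_minus)

theorem corollary6p4:
  shows
    "(\<forall>p q. p \<noteq> 0 \<longrightarrow> (HH p q :: 'k::field_char_0 fspace set set) = {BH p q}) \<and>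
     (\<forall>p q. p \<noteq> 0 \<and> p \<noteq> 1 \<longrightarrow> (tHH p q :: 'k fspace set set set) = {tBH p q}) \<and>
     (\<forall>q. (tHH 1 q :: 'k fspace set set set) =
        (\<lambda>x. (x +o Loops 1 q) +o tBH 1 q) ` fs.span (basis ` one_vertex_trees q)) \<and>
     (\<forall>p q. (HV p q :: 'k fspace set set) = {BV p q}) \<and>
     (\<forall>p q. (tHV p q :: 'k fspace set set set) = {tBV p q})"
proof (intro conjI allI impI)
  have sub_dH: "fs.subspace (dH ` Omega p q :: 'k fspace set)" for p q
    using subspace_Omega dH_add dH_scale dH_0 by (rule subspace_image)
  have sub_dV: "fs.subspace (dV ` Omega p q :: 'k fspace set)" for p q
    using subspace_Omega dV_add dV_scale dV_0 by (rule subspace_image)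
  have sub_BV: "fs.subspace (BV p q :: 'k fspace set)" for p q
    using sub_dV by (simp add: BV_def fs.subspace_single_0)
  have BV_Omega: "y \<in> Omega p q" if "y \<in> BV p q" for y :: "'k fspace" and p q
    using that dV_Omega fs.subspace_0[OF subspace_Omega] by (cases q) (auto simp: BV_def)
  have BV: "\<exists>y\<in>BV p q. \<forall>F. b \<or> \<not> has_loop F \<longrightarrow> Poly_Mapping.lookup x F = Poly_Mapping.lookup y F"
    if "x \<in> Omega p q" "\<And>F. b \<or> \<not> has_loop F \<Longrightarrow> Poly_Mapping.lookup (dV x) F = 0"
    for b p q and x :: "'k fspace"
    unfolding BV_def using that by (rule dV_exact)
  {
    fix p q :: nat assume "p \<noteq> 0"
    then obtain p' where p: "p = Suc p'" by (cases p) auto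
    have "x \<in> BH p q" if x: "x \<in> Omega p q" "dH x = 0" for x :: "'k fspace"
    proof -
      obtain z where z: "z \<in> Omega (Suc p) q" "\<forall>F. Poly_Mapping.lookup x F = Poly_Mapping.lookup (dH z) F"
        using dH_exact[of x p' q True] x unfolding p by auto
      then have "x = dH z" by (intro poly_mapping_eqI) simp
      then show ?thesis using z(1) by (simp add: BH_def)
    qed
    then show "(HH p q :: 'k fspace set set) = {BH p q}"
      unfolding HH_def using sub_dH fs.subspace_0[OF subspace_Omega] dH_0
      by (intro homology_trivial) (auto simp: BH_def)
  next
    fix p q :: nat assume "p \<noteq> 0 \<and> p \<noteq> 1"
    then obtain p' where p: "p = Suc p'" "p \<ge> 2" by (cases p) auto
    have "\<exists>b\<in>dH ` Omega (Suc p) q. x - b \<in> Loops p q"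
      if x: "x \<in> Omega p q" "dH x \<in> Loops p' q" for x :: "'k fspace"
    proof -
      obtain z where z: "z \<in> Omega (Suc p) q"
        "\<And>F. \<not> has_loop F \<Longrightarrow> num_verts F \<noteq> 1 \<Longrightarrow> Poly_Mapping.lookup (x - dH z) F = 0"
        using dH_quotient_exact[of x p' q] x unfolding p by blast
      have r: "x - dH z \<in> Omega p q"
        using fs.subspace_diff[OF subspace_Omega x(1)] dH_Omega[OF z(1)] .
      \<comment> \<open>Two trees need two vertices, so the exceptional forests do not occur for
        \<open>p \<ge> 2\<close>.\<close>
      moreover have "Poly_Mapping.lookup (x - dH z) F = 0" if "num_verts F = 1" for F
        using keys_Omega(1)[OF r, of F] num_le_num_verts(1)[of F] that p(2)
        by (auto simp: in_keys_iff)
      ultimately show ?thesis using z unfolding Loops_iff by blast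
    qed
    moreover have "0 \<in> {x \<in> Omega (Suc p') q. dH x \<in> (Loops p' q :: 'k fspace set)}"
      by (simp add: fs.subspace_0 subspace_Omega subspace_Loops dH_0)
    ultimately show "(tHH p q :: 'k fspace set set set) = {tBH p q}"
      unfolding p(1) tHH_eq tBH_eq
      by (intro quotient_homology_trivial subspace_Loops sub_dH) auto
  next
    fix q :: nat
    let ?L = "Loops 1 q :: 'k fspace set" and ?B = "dH ` Omega 2 q :: 'k fspace set"
    let ?c = "\<lambda>x. (x +o ?L) +o ((\<lambda>b. b +o ?L) ` ?B)"
    let ?Z = "{x \<in> Omega 1 q. dH x \<in> Loops 0 q} :: 'k fspace set"
    let ?S = "fs.span (basis ` one_vertex_trees q) :: 'k fspace set"
    have "?c x \<in> ?c ` ?S" if "x \<in> ?Z" for x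
    proof -
      have x: "x \<in> Omega 1 q" "dH x \<in> Loops 0 q" using that by auto
      obtain z where z: "z \<in> Omega 2 q"
        "\<And>F. \<not> has_loop F \<Longrightarrow> num_verts F \<noteq> 1 \<Longrightarrow> Poly_Mapping.lookup (x - dH z) F = 0"
        using dH_quotient_exact[of x 0 q] x by (auto simp: numeral_2_eq_2)
      define r where "r = x - dH z"
      have r: "r \<in> Omega 1 q"
        unfolding r_def using dH_Omega[of z 1 q] z(1)
        by (intro fs.subspace_diff[OF subspace_Omega x(1)]) (simp add: numeral_2_eq_2)
      \<comment> \<open>The part of the remainder on one-vertex trees; it will represent the class
        of \<open>x\<close>.\<close>
      define y where "y = (\<Sum>F\<in>Poly_Mapping.keys r \<inter> one_vertex_trees q.
        scale (Poly_Mapping.lookup r F) (basis F))"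
      have y: "y \<in> ?S" unfolding y_def by (intro fs.span_sum fs.span_scale fs.span_base) auto
      have y_lookup: "Poly_Mapping.lookup y F =
          (if F \<in> one_vertex_trees q then Poly_Mapping.lookup r F else 0)" for F
      proof -
        have "Poly_Mapping.lookup y F = (\<Sum>F'\<in>Poly_Mapping.keys r \<inter> one_vertex_trees q.
            if F' = F then Poly_Mapping.lookup r F' else 0)"
          unfolding y_def lookup_sum by (intro sum.cong refl) (simp add: lookup_scale lookup_basis)
        then show ?thesis by (simp add: in_keys_iff)
      qed
      have "r - y \<in> ?L"
        unfolding Loops_iff
      proof (intro conjI allI impI)
        show "r - y \<in> Omega 1 q"
          using fs.subspace_diff[OF subspace_Omega r] one_vertex_trees_Omega[OF y] .
        fix F assume F: "\<not> has_loop F"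
        show "Poly_Mapping.lookup (r - y) F = 0"
        \<comment> \<open>Away from loops \<open>r\<close> is supported on one-vertex forests. As
          \<open>r\<close> lies in \<open>Omega 1 q\<close>, these belong to
          \<open>one_vertex_trees q\<close>, where \<open>y\<close> agrees with
          \<open>r\<close>.\<close>
        proof (cases "F \<in> Poly_Mapping.keys r \<and> num_verts F = 1")
          case True
          then show ?thesis using keys_Omega[OF r, of F] y_lookup[of F]
            by (simp add: one_vertex_trees_def lookup_minus)
        next
          case False
          then have "Poly_Mapping.lookup r F = 0" using z(2) F unfolding r_def in_keys_iff by blast
          then show ?thesis using y_lookup[of F] by (simp add: lookup_minus)
        qed
      qed
      \<comment> \<open>The difference \<open>x - (y + dH z)\<close> is \<open>r - y\<close>, so
        \<open>x\<close> and \<open>y\<close> agree up to a boundary and loops.\<close>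
      then have "?c x = ?c y"
        using z(1) by (intro coset_of_cosets_cong[of _ _ "dH z"] subspace_Loops sub_dH)
          (auto simp: r_def algebra_simps)
      then show ?thesis using y by blast
    qed
    moreover have "?S \<subseteq> ?Z" using one_vertex_trees_Omega dH_one_vertex_trees by auto
    ultimately have "?c ` ?Z = ?c ` ?S" by blast
    then show "(tHH 1 q :: 'k fspace set set set) =
        (\<lambda>x. (x +o Loops 1 q) +o tBH 1 q) ` fs.span (basis ` one_vertex_trees q)"
      using tHH_eq[of 0 q, where ?'k = 'k]
      by (simp add: homology_def image_image tBH_eq numeral_2_eq_2)
  next
    fix p q :: nat
    have "x \<in> BV p q" if x: "x \<in> Omega p q" "dV x = 0" for x :: "'k fspace"
    proof -
      obtain y where y: "y \<in> BV p q" "\<forall>F. Poly_Mapping.lookup x F = Poly_Mapping.lookup y F"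
        using BV[of x p q True] x by auto
      then have "x = y" by (intro poly_mapping_eqI) simp
      then show ?thesis using y(1) by simp
    qed
    then show "(HV p q :: 'k fspace set set) = {BV p q}"
      unfolding HV_def using sub_BV fs.subspace_0[OF subspace_Omega] dV_0
      by (intro homology_trivial) auto
  next
    fix p q :: nat
    have "\<exists>b\<in>BV p q. x - b \<in> Loops p q"
      if x: "x \<in> Omega p q" "dV x \<in> Loops p (Suc q)" for x :: "'k fspace"
    proof -
      obtain y where y: "y \<in> BV p q"
        "\<forall>F. \<not> has_loop F \<longrightarrow> Poly_Mapping.lookup x F = Poly_Mapping.lookup y F"
        using BV[of x p q False] x unfolding Loops_iff by auto
      have "x - y \<in> Omega p q" using fs.subspace_diff[OF subspace_Omega x(1) BV_Omega[OF y(1)]] .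
      then have "x - y \<in> Loops p q" using y(2) by (simp add: Loops_iff lookup_minus)
      then show ?thesis using y(1) by blast
    qed
    moreover have "0 \<in> {x \<in> Omega p q. dV x \<in> (Loops p (Suc q) :: 'k fspace set)}"
      by (simp add: fs.subspace_0 subspace_Omega subspace_Loops dV_0)
    ultimately show "(tHV p q :: 'k fspace set set set) = {tBV p q}"
      unfolding tHV_eq tBV_eq
      by (intro quotient_homology_trivial subspace_Loops sub_BV) auto
  }
qed

end
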